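(* Suppose the sensor messages take values in a finite alphabet $\{0,1,\dots,l-1\}$ with $l\ge2$. Then for each $m=0,\dots,M-1$ a maximin quantizer $\bar\phi^{\max}_m$ exists and can be realized as a randomization of at most $M-1$ deterministic quantizers. Moreover, for every $m$ there is a sequence of quantizers $\{\bar\phi_{m,i}\}_{i\ge1}$, each a randomization of at most $M-1$ ULQs, such that $I(m;\bar\phi_{m,i})\to I(m)$ as $i\to\infty$.
   Context: Setting: a raw observation $X$ has, under state $m\in\{0,\dots,M-1\}$ (probability $\mathbf P_m$), density $f_m$ with respect to a common $\sigma$-finite measure. Standing assumption: for all $m\neq m'$, $0<\mathbf E_m[\log(f_m(X)/f_{m'}(X))]<\infty$. A deterministic quantizer is a measurable map $\phi$ from the observation space to $\{0,\dots,l-1\}$; $\Phi$ is their set. A randomized quantizer $\bar\phi=\sum_j p^j\phi^j$ is a probability distribution $(p^j)$ on a countable set $\{\phi^j\}\subset\Phi$; $\bar\Phi$ is the set of all quantizers (deterministic ones included as point masses). $f_m(u;\phi)=\mathbf P_m(\phi(X)=u)$, $I(m,m';\phi)=\sum_{u=0}^{l-1}f_m(u;\phi)\log\frac{f_m(u;\phi)}{f_{m'}(u;\phi)}$, $I(m,m';\bar\phi)=\sum_jp^jI(m,m';\phi^j)$, $I(m;\bar\phi)=\min_{m'\neq m}I(m,m';\bar\phi)$, $I(m)=\sup_{\bar\phi\in\bar\Phi}I(m;\bar\phi)$; a maximin quantizer for $m$ is a $\bar\phi$ with $I(m;\bar\phi)=I(m)$. A deterministic quantizer $\phi$ is an unambiguous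 likelihood quantizer (ULQ) if there are reals $\{a_{i,m}:0\le i\le l-1,\,0\le m\le M-1\}$ with $\phi(X)=\arg\min_{0\le i\le l-1}\sum_{m}a_{i,m}f_m(X)$ and the probability of a tie in this minimum is zero under every $\mathbf P_m$. *)

theory Defs
  imports "HOL-Probability.Probability"
begin

text \<open>States are indexed by naturals m < M, messages by naturals u < l.
  The raw observation lives in the measure space mu; f m is the density of P_m.\<close>

definition Pm :: "'a measure \<Rightarrow> (nat \<Rightarrow> 'a \<Rightarrow> real) \<Rightarrow> nat \<Rightarrow> 'a measure" where
  "Pm mu f m = density mu (\<lambda>x. ennreal (f m x))"

definition det_quantizer :: "'a measure \<Rightarrow> nat \<Rightarrow> ('a \<Rightarrow> nat) \<Rightarrow> bool" where
  "det_quantizer mu l phi \<longleftrightarrow>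
     phi \<in> measurable mu (count_space UNIV) \<and> (\<forall>x\<in>space mu. phi x < l)"

definition quantizer :: "'a measure \<Rightarrow> nat \<Rightarrow> ('a \<Rightarrow> nat) pmf \<Rightarrow> bool" where
  "quantizer mu l p \<longleftrightarrow> set_pmf p \<subseteq> {phi. det_quantizer mu l phi}"

definition qpmf :: "'a measure \<Rightarrow> (nat \<Rightarrow> 'a \<Rightarrow> real) \<Rightarrow> nat \<Rightarrow> ('a \<Rightarrow> nat) \<Rightarrow> nat \<Rightarrow> real" where
  "qpmf mu f m phi u = measure (Pm mu f m) (phi -` {u} \<inter> space mu)"

text \<open>I(m,m';phi) for deterministic phi (natural logarithm; 0 log 0 = 0 automatically).\<close>
definition Idet :: "'a measure \<Rightarrow> (nat \<Rightarrow> 'a \<Rightarrow> real) \<Rightarrow> nat \<Rightarrow> nat \<Rightarrow> nat \<Rightarrow> ('a \<Rightarrow> nat) \<Rightarrow> real" where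
  "Idet mu f l m m' phi =
     (\<Sum>u<l. qpmf mu f m phi u * ln (qpmf mu f m phi u / qpmf mu f m' phi u))"

definition Irand :: "'a measure \<Rightarrow> (nat \<Rightarrow> 'a \<Rightarrow> real) \<Rightarrow> nat \<Rightarrow> nat \<Rightarrow> nat \<Rightarrow> ('a \<Rightarrow> nat) pmf \<Rightarrow> real" where
  "Irand mu f l m m' p = measure_pmf.expectation p (Idet mu f l m m')"

definition Imin :: "'a measure \<Rightarrow> (nat \<Rightarrow> 'a \<Rightarrow> real) \<Rightarrow> nat \<Rightarrow> nat \<Rightarrow> nat \<Rightarrow> ('a \<Rightarrow> nat) pmf \<Rightarrow> real" where
  "Imin mu f M l m p = Min ((\<lambda>m'. Irand mu f l m m' p) ` ({..<M} - {m}))"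

definition Imax :: "'a measure \<Rightarrow> (nat \<Rightarrow> 'a \<Rightarrow> real) \<Rightarrow> nat \<Rightarrow> nat \<Rightarrow> nat \<Rightarrow> real" where
  "Imax mu f M l m = (SUP p\<in>{p. quantizer mu l p}. Imin mu f M l m p)"

definition maximin :: "'a measure \<Rightarrow> (nat \<Rightarrow> 'a \<Rightarrow> real) \<Rightarrow> nat \<Rightarrow> nat \<Rightarrow> nat \<Rightarrow> ('a \<Rightarrow> nat) pmf \<Rightarrow> bool" where
  "maximin mu f M l m p \<longleftrightarrow> quantizer mu l p \<and> Imin mu f M l m p = Imax mu f M l m"

definition ULQ :: "'a measure \<Rightarrow> (nat \<Rightarrow> 'a \<Rightarrow> real) \<Rightarrow> nat \<Rightarrow> nat \<Rightarrow> ('a \<Rightarrow> nat) \<Rightarrow> bool" where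
  "ULQ mu f M l phi \<longleftrightarrow> det_quantizer mu l phi \<and>
     (\<exists>a :: nat \<Rightarrow> nat \<Rightarrow> real.
        let g = (\<lambda>i x. \<Sum>m<M. a i m * f m x) in
        (\<forall>x\<in>space mu. \<forall>i<l. g (phi x) x \<le> g i x) \<and>
        (\<forall>m<M. emeasure (Pm mu f m)
           {x\<in>space mu. \<exists>i<l. \<exists>j<l. i \<noteq> j \<and> g i x = g j x \<and> (\<forall>k<l. g i x \<le> g k x)} = 0))"

end

theory Submission
  imports Defs
begin

text \<open>
  Write q(phi) for the vector of the message probabilities of a quantizer phi under all states.
  Each information number is a convex function of q(phi), and by the integrability of the
  log-likelihood ratios it is continuous along convergent sequences of such vectors, even where
  probabilities vanish.

  Existence. Among finite randomizations, maximize I(m; .) and, in the second place, the mean of the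
  squared norm of the message distribution under P_m. Along a maximizing sequence with convergent
  weights and vectors, exchange two late terms of a component with positive limit weight on an
  arbitrary event and use the two resulting quantizers with equal probability. By convexity and
  continuity this is asymptotically harmless for I(m; .), so strict convexity of the secondary
  objective forces the exchange to become negligible. Hence the component is Cauchy in probability
  and converges to a deterministic quantizer. This replaces Lyapunov's theorem and extreme point
  arguments.

  Number of points. A randomization of at least M quantizers admits a change of weights which
  shifts all M - 1 information numbers by the same amount; moving in the favourable direction until
  a weight vanishes removes one point.

  ULQs. A linear functional of q(phi) is minimized by a likelihood quantizer, up to an arbitrarily
  small perturbation a ULQ, so the Frank-Wolfe method approximates any q(phi) by mixtures of ULQs;
  convexity of the information numbers does the rest.
\<close>

subsection \<open>Reducing the support of a mixture\<close>

text \<open>Gaussian elimination: an equation with a nonzero coefficient at \<open>v\<close> is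
  solved for the unknown \<open>v\<close> and substituted into the others, which removes one
  equation and one unknown.\<close>

lemma homogeneous_system_nontrivial:
  fixes A :: "'e \<Rightarrow> 'u \<Rightarrow> real"
  assumes "finite E" "finite U" "card E < card U"
  shows "\<exists>x. (\<exists>u\<in>U. x u \<noteq> 0) \<and> (\<forall>e\<in>E. (\<Sum>u\<in>U. A e u * x u) = 0)"
  using assms
proof (induction E arbitrary: U A rule: finite_induct)
  case empty
  then obtain u where "u \<in> U" by fastforce
  then show ?case by (intro exI[of _ "\<lambda>_. 1"]) auto
next
  case (insert e E)
  show ?case
  proof (cases "\<forall>u\<in>U. A e u = 0")
    case True
    obtain x where "\<exists>u\<in>U. x u \<noteq> 0" "\<forall>e\<in>E. (\<Sum>u\<in>U. A e u * x u) = 0"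
      using insert.IH[of U A] insert.prems insert.hyps by auto
    with True show ?thesis by auto
  next
    case False
    then obtain v where v: "v \<in> U" "A e v \<noteq> 0" by auto
    define U' where "U' = U - {v}"
    define B where "B e' u = A e' u - A e' v * A e u / A e v" for e' u
    have "card E < card U'" "finite U'"
      using insert.prems insert.hyps v by (auto simp: U'_def)
    then obtain x where x: "\<exists>u\<in>U'. x u \<noteq> 0" "\<forall>e\<in>E. (\<Sum>u\<in>U'. B e u * x u) = 0"
      using insert.IH[of U' B] by auto
    define s where "s = (\<Sum>u\<in>U'. A e u * x u)"
    define y where "y = x(v := - s / A e v)"
    have sum: "(\<Sum>u\<in>U. A e' u * y u) = (\<Sum>u\<in>U'. A e' u * x u) - A e' v * s / A e v" for e'
    proof -
      have "(\<Sum>u\<in>U. A e' u * y u) = A e' v * y v + (\<Sum>u\<in>U'. A e' u * y u)"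
        using v insert.prems by (auto simp: U'_def sum.remove)
      also have "(\<Sum>u\<in>U'. A e' u * y u) = (\<Sum>u\<in>U'. A e' u * x u)"
        by (intro sum.cong) (auto simp: U'_def y_def)
      finally show ?thesis by (simp add: y_def)
    qed
    have "(\<Sum>u\<in>U. A e' u * y u) = 0" if "e' \<in> E" for e'
    proof -
      have "0 = (\<Sum>u\<in>U'. B e' u * x u)" using x that by simp
      also have "\<dots> = (\<Sum>u\<in>U'. A e' u * x u) - (A e' v / A e v) * s"
        unfolding s_def sum_distrib_left by (simp add: B_def algebra_simps sum_subtractf)
      finally show ?thesis using sum[of e'] by simp
    qed
    moreover have "(\<Sum>u\<in>U. A e u * y u) = 0"
      using v unfolding sum by (simp add: s_def)
    moreover have "\<exists>u\<in>U. y u \<noteq> 0"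
      using x(1) by (auto simp: y_def U'_def)
    ultimately show ?thesis by auto
  qed
qed

text \<open>Besides the affine dependencies of Caratheodory's theorem, moves along the diagonal
  direction that increase all coordinates equally are allowed; this saves one point.\<close>
lemma mixture_support_reduction:
  fixes v :: "'j \<Rightarrow> 'a \<Rightarrow> real"
  assumes "finite A" "finite J" "J \<noteq> {}"
    and "\<And>a. a \<in> A \<Longrightarrow> 0 \<le> w a" "sum w A = 1"
  shows "\<exists>B w'. B \<subseteq> A \<and> card B \<le> card J \<and> (\<forall>a\<in>B. 0 \<le> w' a) \<and> sum w' B = 1 \<and>
           (\<forall>j\<in>J. (\<Sum>a\<in>A. w a * v j a) \<le> (\<Sum>a\<in>B. w' a * v j a))"
  using assms(1,4,5)
proof (induction "card A" arbitrary: A w rule: less_induct)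
  case less
  show ?case
  proof (cases "card A \<le> card J")
    case True
    then show ?thesis using less.prems by (intro exI[of _ A] exI[of _ w]) auto
  next
    case False
    \<comment> \<open>The equation \<open>None\<close> preserves the total weight; the equation of
      \<open>j\<close> says that the \<open>j\<close>-th mean changes by a common shift, which is
      the extra unknown \<open>None\<close>. There are \<open>card J + 1\<close> equations and
      \<open>card A + 1\<close> unknowns, so \<open>card J < card A\<close> yields a nontrivial
      solution.\<close>
    define E where "E = insert None (Some ` J)"
    define U where "U = insert None (Some ` A)"
    define C where "C e u = (case u of None \<Rightarrow> (case e of None \<Rightarrow> 0 | Some j \<Rightarrow> - 1)
       | Some a \<Rightarrow> (case e of None \<Rightarrow> 1 | Some j \<Rightarrow> v j a))" for e u
    have "finite E" "finite U" "card E < card U"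
      using False less.prems assms by (auto simp: E_def U_def card_image)
    from homogeneous_system_nontrivial[OF this, of C] obtain x where
      x: "\<exists>u\<in>U. x u \<noteq> 0" "\<And>e. e \<in> E \<Longrightarrow> (\<Sum>u\<in>U. C e u * x u) = 0" by auto
    have sumU: "(\<Sum>u\<in>U. C e u * x u) = C e None * x None + (\<Sum>a\<in>A. C e (Some a) * x (Some a))" for e
      using less.prems by (simp add: U_def sum.reindex)
    obtain d s where ds: "\<exists>a\<in>A. d a \<noteq> 0" "0 \<le> s" "(\<Sum>a\<in>A. d a) = 0"
      "\<And>j. j \<in> J \<Longrightarrow> (\<Sum>a\<in>A. d a * v j a) = s"
    proof -
      \<comment> \<open>A change of sign makes the common shift nonnegative, which is the favourable
        direction.\<close>
      define \<sigma> :: real where "\<sigma> = (if x None \<ge> 0 then 1 else - 1)"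
      have e0: "(\<Sum>a\<in>A. x (Some a)) = 0"
        using x(2)[of None] unfolding sumU by (simp add: E_def C_def)
      have ej: "(\<Sum>a\<in>A. v j a * x (Some a)) = x None" if "j \<in> J" for j
        using x(2)[of "Some j"] that unfolding sumU by (simp add: E_def C_def)
      \<comment> \<open>The solution cannot consist of the shift alone: as \<open>J\<close> is
        nonempty, unchanged weights force the shift to be 0.\<close>
      have nz: "\<exists>a\<in>A. x (Some a) \<noteq> 0"
      proof (rule ccontr)
        assume *: "\<not> ?thesis"
        obtain j where "j \<in> J" using assms by auto
        with ej[of j] * have "x None = 0" by simp
        with * x(1) show False by (auto simp: U_def)
      qed
      show ?thesis
      proof (rule that[of "\<lambda>a. \<sigma> * x (Some a)" "\<sigma> * x None"])
        show "(\<Sum>a\<in>A. \<sigma> * x (Some a)) = 0" using e0 by (simp flip: sum_distrib_left)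
        show "(\<Sum>a\<in>A. \<sigma> * x (Some a) * v j a) = \<sigma> * x None" if "j \<in> J" for j
          using ej[OF that] by (simp add: mult_ac flip: sum_distrib_left)
      qed (use nz in \<open>auto simp: \<sigma>_def\<close>)
    qed
    \<comment> \<open>Some weight decreases, since \<open>d\<close> is not zero but sums to 0. The
      smallest ratio \<open>w b / - d b\<close> is the longest step that keeps all weights
      nonnegative, and it makes the weight of \<open>b\<close> vanish.\<close>
    define Neg where "Neg = {a\<in>A. d a < 0}"
    have "Neg \<noteq> {}"
    proof
      assume "Neg = {}"
      then have "\<forall>a\<in>A. 0 \<le> d a" by (auto simp: Neg_def not_less)
      with ds less.prems show False by (simp add: sum_nonneg_eq_0_iff)
    qed
    moreover have "finite Neg" using less.prems by (simp add: Neg_def)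
    ultimately obtain b where b: "b \<in> Neg" "\<And>a. a \<in> Neg \<Longrightarrow> w b / - d b \<le> w a / - d a"
      using ex_min_if_finite[of "(\<lambda>a. w a / - d a) ` Neg"] by (fastforce simp: not_less)
    define t where "t = w b / - d b"
    have bA: "b \<in> A" "d b < 0" using b by (auto simp: Neg_def)
    have t0: "0 \<le> t" using bA less.prems by (simp add: t_def divide_le_0_iff)
    define w' where "w' a = w a + t * d a" for a
    have w'0: "0 \<le> w' a" if "a \<in> A" for a
    proof (cases "d a < 0")
      case True
      then have "t \<le> w a / - d a" using b that by (auto simp: Neg_def t_def)
      then have "t * - d a \<le> w a" using True by (subst (asm) pos_le_divide_eq) auto
      then show ?thesis by (simp add: w'_def)
    next
      case False
      then show ?thesis using t0 less.prems that by (auto simp: w'_def)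
    qed
    have w'b: "w' b = 0" using bA by (simp add: w'_def t_def)
    have rem: "(\<Sum>a\<in>A - {b}. w' a * g a) = (\<Sum>a\<in>A. w' a * g a)" for g :: "'a \<Rightarrow> real"
      using less.prems bA w'b by (simp add: sum.remove)
    have exp: "(\<Sum>a\<in>A. w' a * g a) = (\<Sum>a\<in>A. w a * g a) + t * (\<Sum>a\<in>A. d a * g a)"
      for g :: "'a \<Rightarrow> real"
      unfolding sum_distrib_left by (simp add: w'_def algebra_simps sum.distrib)
    have "sum w' (A - {b}) = 1"
      using rem[of "\<lambda>_. 1"] exp[of "\<lambda>_. 1"] ds less.prems by simp
    moreover have "card (A - {b}) < card A" using less.prems bA by (intro card_Diff1_less) auto
    ultimately have "\<exists>B w''. B \<subseteq> A - {b} \<and> card B \<le> card J \<and> (\<forall>a\<in>B. 0 \<le> w'' a) \<and> sum w'' B = 1 \<and>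
        (\<forall>j\<in>J. (\<Sum>a\<in>A - {b}. w' a * v j a) \<le> (\<Sum>a\<in>B. w'' a * v j a))"
      using less.prems w'0 by (intro less.hyps) auto
    then obtain B w'' where B: "B \<subseteq> A - {b}" "card B \<le> card J" "\<forall>a\<in>B. 0 \<le> w'' a" "sum w'' B = 1"
       "\<forall>j\<in>J. (\<Sum>a\<in>A - {b}. w' a * v j a) \<le> (\<Sum>a\<in>B. w'' a * v j a)"
      by blast
    have "(\<Sum>a\<in>A. w a * v j a) \<le> (\<Sum>a\<in>B. w'' a * v j a)" if "j \<in> J" for j
      using B(5)[rule_format, OF that] ds(4)[OF that] mult_nonneg_nonneg[OF t0 ds(2)]
      unfolding rem exp by simp
    with B show ?thesis by blast
  qed
qed

text \<open>Reindexes the reduced mixture by exactly \<open>card J\<close> indices, padding with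
  weight 0 at a point of the support. A fixed number of terms is what termwise limits of sequences
  of mixtures require.\<close>

lemma mixture_reduction:
  fixes v :: "'j \<Rightarrow> 'a \<Rightarrow> real"
  assumes "finite A" "finite J" "J \<noteq> {}"
    and "\<And>a. a \<in> A \<Longrightarrow> 0 \<le> w a" "sum w A = 1"
  obtains w' h where "\<And>i. i < card J \<Longrightarrow> 0 \<le> w' i" "\<And>i. i < card J \<Longrightarrow> h i \<in> A"
    "(\<Sum>i<card J. w' i) = 1"
    "\<And>j. j \<in> J \<Longrightarrow> (\<Sum>a\<in>A. w a * v j a) \<le> (\<Sum>i<card J. w' i * v j (h i))"
proof -
  from mixture_support_reduction[where v=v, OF assms]
  obtain B u where B: "B \<subseteq> A" "card B \<le> card J" "\<And>a. a \<in> B \<Longrightarrow> 0 \<le> u a" "sum u B = 1"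
    "\<And>j. j \<in> J \<Longrightarrow> (\<Sum>a\<in>A. w a * v j a) \<le> (\<Sum>a\<in>B. u a * v j a)" by metis
  have finB: "finite B" using B assms finite_subset by blast
  have "B \<noteq> {}" using B by auto
  then obtain b where b: "b \<in> B" by auto
  obtain g where g: "bij_betw g {..<card B} B"
    using finB ex_bij_betw_nat_finite atLeast0LessThan by metis
  define h where "h i = (if i < card B then g i else b)" for i
  define w' where "w' i = (if i < card B then u (g i) else 0)" for i
  have hB: "h i \<in> B" for i using g b by (auto simp: h_def bij_betw_def)
  have sum: "(\<Sum>i<card J. w' i * c (h i)) = (\<Sum>a\<in>B. u a * c a)" for c :: "'a \<Rightarrow> real"
  proof -
    have "(\<Sum>i<card J. w' i * c (h i)) = (\<Sum>i<card B. w' i * c (h i))"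
      using B(2) by (intro sum.mono_neutral_right) (auto simp: w'_def)
    also have "\<dots> = (\<Sum>i<card B. u (g i) * c (g i))"
      by (intro sum.cong) (auto simp: w'_def h_def)
    also have "\<dots> = (\<Sum>a\<in>B. u a * c a)"
      by (rule sum.reindex_bij_betw[OF g])
    finally show ?thesis .
  qed
  show ?thesis
  proof (rule that[of w' h])
    show "0 \<le> w' i" for i using hB[of i] B(3) by (auto simp: w'_def h_def)
    show "h i \<in> A" for i using hB B by auto
    show "(\<Sum>i<card J. w' i) = 1" using sum[of "\<lambda>_. 1"] B by simp
    show "(\<Sum>a\<in>A. w a * v j a) \<le> (\<Sum>i<card J. w' i * v j (h i))" if "j \<in> J" for j
      using B(5)[OF that] sum by simp
  qed
qed

section \<open>Compactness, truncation and finite mixtures\<close>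

lemma common_convergent_subsequence:
  fixes x :: "'i \<Rightarrow> nat \<Rightarrow> real"
  assumes "finite I" "\<And>i n. i \<in> I \<Longrightarrow> \<bar>x i n\<bar> \<le> B"
  obtains r where "strict_mono (r :: nat \<Rightarrow> nat)" "\<And>i. i \<in> I \<Longrightarrow> convergent (\<lambda>n. x i (r n))"
proof -
  have "\<exists>r :: nat \<Rightarrow> nat. strict_mono r \<and> (\<forall>i\<in>I. convergent (\<lambda>n. x i (r n)))"
    using assms
  proof (induction I rule: finite_induct)
    case empty
    then show ?case by (intro exI[of _ id]) (auto simp: strict_mono_def)
  next
    case (insert i I)
    then obtain r :: "nat \<Rightarrow> nat" where r: "strict_mono r" "\<forall>i\<in>I. convergent (\<lambda>n. x i (r n))"
      by auto
    have "bounded (range (\<lambda>n. x i (r n)))"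
      using insert.prems by (auto simp: bounded_iff intro!: exI[of _ B])
    then obtain L s where s: "strict_mono (s :: nat \<Rightarrow> nat)" "((\<lambda>n. x i (r n)) \<circ> s) \<longlonglongrightarrow> L"
      using bounded_imp_convergent_subsequence by metis
    have "convergent (\<lambda>n. x j (r (s n)))" if "j \<in> I" for j
      using convergent_subseq_convergent[OF r(2)[rule_format, OF that] s(1)] by (simp add: o_def)
    with s r show ?case
      by (intro exI[of _ "r \<circ> s"]) (auto simp: o_def convergent_def intro: strict_mono_o[unfolded o_def])
  qed
  with that show ?thesis by blast
qed

text \<open>Restrict \<open>p\<close> to a finite set of mass \<open>t\<close> close to 1 and divide
  by \<open>t\<close>. As the values are nonnegative and \<open>t\<close> is at most 1, the division
  only increases the sum, so the whole loss is the tail, at most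
  \<open>\<bar>C\<bar> * (1 - t)\<close>.\<close>

lemma pmf_truncation:
  fixes v :: "'j \<Rightarrow> 'b \<Rightarrow> real"
  assumes "\<And>j a. j \<in> J \<Longrightarrow> a \<in> set_pmf p \<Longrightarrow> 0 \<le> v j a \<and> v j a \<le> C" "0 < e"
  obtains A w where "finite A" "A \<subseteq> set_pmf p" "\<And>a. a \<in> A \<Longrightarrow> 0 \<le> w a" "sum w A = 1"
    "\<And>j. j \<in> J \<Longrightarrow> measure_pmf.expectation p (v j) - e \<le> (\<Sum>a\<in>A. w a * v j a)"
proof -
  define A where "A n = from_nat_into (set_pmf p) ` {..<n}" for n :: nat
  have ran: "range (from_nat_into (set_pmf p)) = set_pmf p"
    by (simp add: range_from_nat_into set_pmf_not_empty)
  have sub: "A n \<subseteq> set_pmf p" for n using ran by (auto simp: A_def)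
  have "(\<Union>n. A n) = range (from_nat_into (set_pmf p))" by (auto simp: A_def)
  then have "(\<Union>n. A n) = set_pmf p" by (simp only: ran)
  moreover have "incseq A" by (auto simp: A_def incseq_def)
  ultimately have "(\<lambda>n. measure_pmf.prob p (A n)) \<longlonglongrightarrow> measure_pmf.prob p (set_pmf p)"
    using measure_pmf.finite_Lim_measure_incseq[of A p] by simp
  moreover have "measure_pmf.prob p (set_pmf p) = 1"
    by (subst measure_pmf.prob_eq_1) (auto simp: AE_measure_pmf_iff)
  ultimately have lim: "(\<lambda>n. measure_pmf.prob p (A n)) \<longlonglongrightarrow> 1" by simp
  \<comment> \<open>The bound 1/2 keeps the retained mass positive; the other bound makes the lost
    tail cost at most \<open>e\<close>.\<close>
  define \<eta> where "\<eta> = min (1/2) (e / (\<bar>C\<bar> + 1))"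
  have eta: "0 < \<eta>" "\<eta> < 1" using assms(2) by (auto simp: \<eta>_def)
  have "\<forall>\<^sub>F n in sequentially. 1 - \<eta> < measure_pmf.prob p (A n)"
    using order_tendstoD(1)[OF lim] eta by simp
  then obtain n where n: "1 - \<eta> < measure_pmf.prob p (A n)"
    by (auto simp: eventually_sequentially)
  define B where "B = A n"
  define t where "t = measure_pmf.prob p B"
  have t: "1 - \<eta> < t" "0 < t" "t \<le> 1" using n eta by (auto simp: t_def B_def)
  have finB: "finite B" by (simp add: B_def A_def)
  have tsum: "t = (\<Sum>a\<in>B. pmf p a)" using finB by (simp add: t_def measure_measure_pmf_finite)
  show ?thesis
  proof (rule that[of B "\<lambda>a. pmf p a / t"])
    show "B \<subseteq> set_pmf p" using sub by (simp add: B_def)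
    show "(\<Sum>a\<in>B. pmf p a / t) = 1" using t tsum by (simp flip: sum_divide_distrib)
    show "measure_pmf.expectation p (v j) - e \<le> (\<Sum>a\<in>B. pmf p a / t * v j a)" if j: "j \<in> J" for j
    proof -
      have int: "integrable (measure_pmf p) (\<lambda>a. v j a * indicator S a)" for S
        using assms(1)[OF j]
        by (intro measure_pmf.integrable_const_bound[where B = "\<bar>C\<bar>"]) 
           (fastforce simp: AE_measure_pmf_iff indicator_def)+
      have "measure_pmf.expectation p (v j)
          = measure_pmf.expectation p (\<lambda>a. v j a * indicator B a + v j a * indicator (-B) a)"
        by (intro Bochner_Integration.integral_cong) (auto simp: indicator_def)
      also have "\<dots> = measure_pmf.expectation p (\<lambda>a. v j a * indicator B a)
          + measure_pmf.expectation p (\<lambda>a. v j a * indicator (-B) a)"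
        by (intro Bochner_Integration.integral_add int)
      also have "measure_pmf.expectation p (\<lambda>a. v j a * indicator (-B) a)
          \<le> measure_pmf.expectation p (\<lambda>a. \<bar>C\<bar> * indicator (-B) a)"
        using assms(1)[OF j]
        by (intro integral_mono_AE int integrable_mult_right measure_pmf.integrable_const_bound[where B=1])
           (fastforce simp: AE_measure_pmf_iff indicator_def)+
      also have "\<dots> = \<bar>C\<bar> * (1 - t)"
        using measure_pmf.prob_compl[of B p] by (simp add: t_def Compl_eq_Diff_UNIV)
      also have "\<dots> \<le> \<bar>C\<bar> * (e / (\<bar>C\<bar> + 1))"
        using t by (intro mult_left_mono) (auto simp: \<eta>_def)
      also have "\<dots> \<le> e" using assms(2) by (simp add: field_simps)
      also have "measure_pmf.expectation p (\<lambda>a. v j a * indicator B a)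
          = (\<Sum>a\<in>B. pmf p a * v j a)"
        using finB by (subst integral_measure_pmf[of B]) (auto simp: indicator_def)
      also have "(\<Sum>a\<in>B. pmf p a * v j a) \<le> (\<Sum>a\<in>B. pmf p a / t * v j a)"
        using t sub[of n] assms(1)[OF j] unfolding B_def
        by (intro sum_mono mult_right_mono) (auto simp: le_divide_eq mult_left_le)
      finally show ?thesis by simp
    qed
  qed (use finB t in auto)
qed

text \<open>Indexed families with possible repetitions and zero weights, instead of distributions: a
  sequence of mixtures of the same length then has limits weight by weight and component by
  component.\<close>

definition mixture :: "'b set \<Rightarrow> nat \<Rightarrow> (nat \<Rightarrow> real) \<Rightarrow> (nat \<Rightarrow> 'b) \<Rightarrow> bool" where
  "mixture S n W \<Phi> \<longleftrightarrow> (\<forall>i<n. 0 \<le> W i \<and> \<Phi> i \<in> S) \<and> (\<Sum>i<n. W i) = 1"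

abbreviation avg :: "nat \<Rightarrow> (nat \<Rightarrow> real) \<Rightarrow> (nat \<Rightarrow> 'b) \<Rightarrow> ('b \<Rightarrow> real) \<Rightarrow> real" where
  "avg n W \<Phi> g \<equiv> (\<Sum>i<n. W i * g (\<Phi> i))"

lemma mixture_mono: "mixture S n W \<Phi> \<Longrightarrow> S \<subseteq> T \<Longrightarrow> mixture T n W \<Phi>"
  by (auto simp: mixture_def)

text \<open>The push-forward of the weights under \<Phi>; repeated components merge, hence at most
  \<open>n\<close> points. Weights are set to 0 from index \<open>n\<close> on because
  \<open>mixture\<close> does not constrain them there.\<close>

lemma mixture_pmf:
  assumes "mixture S n W \<Phi>"
  obtains p where "set_pmf p \<subseteq> S" "finite (set_pmf p)" "card (set_pmf p) \<le> n"
    "\<And>g. measure_pmf.expectation p g = avg n W \<Phi> g"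
proof -
  define w where "w i = (if i < n then W i else 0)" for i
  have "(\<integral>\<^sup>+i. ennreal (w i) \<partial>count_space UNIV) = (\<Sum>i<n. ennreal (w i))"
    by (subst nn_integral_count_space'[of "{..<n}"]) (auto simp: w_def)
  also have "\<dots> = ennreal (\<Sum>i<n. w i)"
    using assms by (intro sum_ennreal) (auto simp: w_def mixture_def)
  also have "(\<Sum>i<n. w i) = 1" using assms by (auto simp: w_def mixture_def)
  finally have one: "(\<integral>\<^sup>+i. ennreal (w i) \<partial>count_space UNIV) = 1" by simp
  have w0: "0 \<le> w i" for i using assms by (auto simp: w_def mixture_def)
  have pmf: "pmf (embed_pmf w) i = w i" for i by (rule pmf_embed_pmf[OF w0 one])
  have set: "set_pmf (embed_pmf w) \<subseteq> {..<n}" by (auto simp: set_pmf_eq pmf w_def)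
  define p where "p = map_pmf \<Phi> (embed_pmf w)"
  have sp: "set_pmf p \<subseteq> \<Phi> ` {..<n}" using set by (auto simp: p_def)
  show ?thesis
  proof (rule that[of p])
    show "set_pmf p \<subseteq> S" using sp assms by (auto simp: mixture_def)
    show "finite (set_pmf p)" using sp finite_subset by blast
    show "card (set_pmf p) \<le> n"
      using card_mono[OF _ sp] card_image_le[of "{..<n}" \<Phi>] by simp
    show "measure_pmf.expectation p g = avg n W \<Phi> g" for g
      unfolding p_def integral_map_pmf using set
      by (subst integral_measure_pmf[of "{..<n}"]) (auto simp: pmf w_def)
  qed
qed

subsection \<open>Convexity and continuity of the information numbers\<close>

text \<open>The function \<open>a * ln (a / b)\<close> is convex and homogeneous of degree one, and
  the left side is its tangent plane at (\<alpha>, \<beta>); the proof is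
  \<open>ln z <= z - 1\<close>. The condition at \<open>b = 0\<close> excludes the infinite value,
  which division by zero would hide.\<close>

lemma relative_entropy_tangent:
  fixes a b \<alpha> \<beta> :: real
  assumes "0 \<le> a" "0 \<le> b" "b = 0 \<Longrightarrow> a = 0" "0 < \<alpha>" "0 < \<beta>"
  shows "a * ln (\<alpha> / \<beta>) + a - b * (\<alpha> / \<beta>) \<le> a * ln (a / b)"
proof (cases "a = 0")
  case False
  then have pos: "a > 0" "b > 0" using assms by (auto simp: less_le)
  have "ln ((b * \<alpha>) / (a * \<beta>)) \<le> (b * \<alpha>) / (a * \<beta>) - 1"
    using pos assms by (intro ln_le_minus_one) auto
  moreover have "ln ((b * \<alpha>) / (a * \<beta>)) = ln (\<alpha> / \<beta>) - ln (a / b)"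
    using pos assms by (simp add: ln_div ln_mult)
  ultimately have "a * (ln (\<alpha> / \<beta>) - ln (a / b)) \<le> a * ((b * \<alpha>) / (a * \<beta>) - 1)"
    using pos by (intro mult_left_mono) auto
  then show ?thesis using pos by (simp add: algebra_simps)
qed (use assms in auto)

text \<open>Average the tangent inequality taken at the mean point (\<alpha>, \<beta>): there the
  linear terms \<alpha> and \<open>\<beta> * (\<alpha> / \<beta>)\<close> cancel.\<close>

lemma log_sum_inequality:
  fixes a b w :: "'i \<Rightarrow> real"
  assumes "finite I" "\<And>i. i \<in> I \<Longrightarrow> 0 \<le> w i" "\<And>i. i \<in> I \<Longrightarrow> 0 \<le> a i" "\<And>i. i \<in> I \<Longrightarrow> 0 \<le> b i"
    "\<And>i. i \<in> I \<Longrightarrow> b i = 0 \<Longrightarrow> a i = 0"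
  shows "(\<Sum>i\<in>I. w i * a i) * ln ((\<Sum>i\<in>I. w i * a i) / (\<Sum>i\<in>I. w i * b i))
           \<le> (\<Sum>i\<in>I. w i * (a i * ln (a i / b i)))"
proof -
  define \<alpha> where "\<alpha> = (\<Sum>i\<in>I. w i * a i)"
  define \<beta> where "\<beta> = (\<Sum>i\<in>I. w i * b i)"
  show ?thesis
  proof (cases "\<alpha> = 0")
    case True
    then have "\<forall>i\<in>I. w i * a i = 0"
      unfolding \<alpha>_def using assms by (subst (asm) sum_nonneg_eq_0_iff) auto
    then have "(\<Sum>i\<in>I. w i * (a i * ln (a i / b i))) = 0" by (intro sum.neutral) auto
    with True show ?thesis by (simp add: \<alpha>_def)
  next
    case False
    have "\<beta> \<noteq> 0"
    proof
      assume "\<beta> = 0"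
      then have "\<forall>i\<in>I. w i * b i = 0"
        unfolding \<beta>_def using assms by (subst (asm) sum_nonneg_eq_0_iff) auto
      then have "\<forall>i\<in>I. w i * a i = 0" using assms by auto
      then have "\<alpha> = 0" unfolding \<alpha>_def by (intro sum.neutral) auto
      then show False using False by simp
    qed
    moreover have "0 \<le> \<alpha>" "0 \<le> \<beta>" using assms by (auto simp: \<alpha>_def \<beta>_def intro!: sum_nonneg)
    ultimately have pos: "0 < \<alpha>" "0 < \<beta>" using False by auto
    have "(\<Sum>i\<in>I. w i * (a i * ln (\<alpha> / \<beta>) + a i - b i * (\<alpha> / \<beta>)))
       \<le> (\<Sum>i\<in>I. w i * (a i * ln (a i / b i)))"
      using assms pos by (intro sum_mono mult_left_mono relative_entropy_tangent) auto
    also have "(\<Sum>i\<in>I. w i * (a i * ln (\<alpha> / \<beta>) + a i - b i * (\<alpha> / \<beta>)))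
       = \<alpha> * ln (\<alpha> / \<beta>) + \<alpha> - \<beta> * (\<alpha> / \<beta>)"
      unfolding \<alpha>_def \<beta>_def sum_distrib_right
      by (simp add: algebra_simps sum.distrib sum_subtractf)
    finally show ?thesis using pos by (simp add: \<alpha>_def \<beta>_def)
  qed
qed

section \<open>Densities, null sets and relative entropy of [0,1]-valued functions\<close>

text \<open>The almost sure positivity in \<open>KL\<close> expresses that the log-likelihood ratio
  is not infinite; the integrability condition alone would miss this, since \<open>f m x / 0\<close>
  is 0.\<close>

locale hypotheses =
  fixes mu :: "'a measure" and f :: "nat \<Rightarrow> 'a \<Rightarrow> real" and M l :: nat
  assumes M2: "M \<ge> 2" and l2: "l \<ge> 2"
    and dens: "\<And>m. m < M \<Longrightarrow> f m \<in> borel_measurable mu \<and> (\<forall>x\<in>space mu. 0 \<le> f m x)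
                 \<and> (\<integral>\<^sup>+ x. ennreal (f m x) \<partial>mu) = 1"
    and KL: "\<And>m m'. m < M \<Longrightarrow> m' < M \<Longrightarrow> m \<noteq> m' \<Longrightarrow>
               (AE x in Pm mu f m. 0 < f m' x)
             \<and> integrable (Pm mu f m) (\<lambda>x. ln (f m x / f m' x))
             \<and> 0 < (\<integral>x. ln (f m x / f m' x) \<partial>Pm mu f m)"
begin

abbreviation P :: "nat \<Rightarrow> 'a measure" where "P \<equiv> Pm mu f"

abbreviation llr :: "nat \<Rightarrow> nat \<Rightarrow> 'a \<Rightarrow> real" where "llr m m' x \<equiv> ln (f m x / f m' x)"

text \<open>Randomized tests. Indicators of message regions are the main example, but averaging over
  the components of a mixture leads to functions with values strictly between 0 and 1.\<close>

definition unit_fun :: "('a \<Rightarrow> real) \<Rightarrow> bool" where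
  "unit_fun g \<longleftrightarrow> g \<in> borel_measurable mu \<and> (\<forall>x\<in>space mu. 0 \<le> g x \<and> g x \<le> 1)"

lemma f_measurable [measurable]: "m < M \<Longrightarrow> f m \<in> borel_measurable mu"
  and f_nonneg: "m < M \<Longrightarrow> x \<in> space mu \<Longrightarrow> 0 \<le> f m x"
  using dens by auto

lemma sets_P [simp, measurable_cong]: "sets (P m) = sets mu"
  and space_P [simp]: "space (P m) = space mu"
  by (auto simp: Pm_def)

lemma prob_space_P: "m < M \<Longrightarrow> prob_space (P m)"
  using dens[of m] by (intro prob_spaceI) (auto simp: Pm_def emeasure_density)

lemma unit_fun_integrable: "m < M \<Longrightarrow> unit_fun g \<Longrightarrow> integrable (P m) g"
proof -
  assume m: "m < M" and g: "unit_fun g"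
  interpret prob_space "P m" by (rule prob_space_P[OF m])
  show ?thesis using g by (intro integrable_const_bound[of _ 1]) (auto simp: unit_fun_def)
qed

lemma unit_fun_integral_bounds:
  assumes "m < M" "unit_fun g"
  shows "0 \<le> (\<integral>x. g x \<partial>P m)" "(\<integral>x. g x \<partial>P m) \<le> 1"
proof -
  interpret prob_space "P m" by (rule prob_space_P[OF assms(1)])
  show "0 \<le> (\<integral>x. g x \<partial>P m)" using assms
    by (intro integral_nonneg_AE) (auto simp: unit_fun_def)
  show "(\<integral>x. g x \<partial>P m) \<le> 1" using assms unit_fun_integrable[OF assms]
    by (intro integral_le_const) (auto simp: unit_fun_def)
qed

lemma AE_P_iff: "m < M \<Longrightarrow> (AE x in P m. Q x) \<longleftrightarrow> (AE x in mu. 0 < f m x \<longrightarrow> Q x)"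
  unfolding Pm_def by (subst AE_density) auto

text \<open>By the positivity clause of \<open>KL\<close>, the sets where \<open>f m\<close> and
  \<open>f m'\<close> are positive agree up to a null set of \<open>mu\<close>, so all
  \<open>P m\<close> have the same null sets.\<close>

lemma AE_P_transfer:
  assumes "m < M" "m' < M" "AE x in P m. Q x"
  shows "AE x in P m'. Q x"
proof (cases "m = m'")
  case False
  have "AE x in mu. 0 < f m x \<longrightarrow> Q x"
    using assms by (simp add: AE_P_iff)
  moreover have "AE x in mu. 0 < f m' x \<longrightarrow> 0 < f m x"
    using KL[of m' m] assms False by (simp add: AE_P_iff)
  ultimately have "AE x in mu. 0 < f m' x \<longrightarrow> Q x" by eventually_elim auto
  then show ?thesis using assms by (simp add: AE_P_iff)
qed (use assms in auto)

lemma integral_eq_0_transfer: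
  assumes "m < M" "m' < M" "unit_fun g" "(\<integral>x. g x \<partial>P m') = 0"
  shows "(\<integral>x. g x \<partial>P m) = 0"
proof -
  have "AE x in P m'. g x = 0"
    using assms unit_fun_integrable[OF assms(2,3)]
    by (subst (asm) integral_nonneg_eq_0_iff_AE) (auto simp: unit_fun_def)
  from AE_P_transfer[OF assms(2,1) this] show ?thesis
    by (rule integral_eq_zero_AE)
qed

lemma integrable_llr:
  assumes "m < M" "m' < M" "m \<noteq> m'" "unit_fun g"
  shows "integrable (P m) (\<lambda>x. g x * llr m m' x)"
proof (rule Bochner_Integration.integrable_bound)
  show "integrable (P m) (llr m m')" using KL assms by auto
  show "(\<lambda>x. g x * llr m m' x) \<in> borel_measurable (P m)"
    using assms by (auto simp: unit_fun_def)
  show "AE x in P m. norm (g x * llr m m' x) \<le> norm (llr m m' x)"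
    using assms by (intro AE_I2) (auto simp: unit_fun_def abs_mult intro!: mult_left_le_one_le)
qed

text \<open>Data processing inequality for a single test: integrate the tangent inequality at the
  two means, applied pointwise to the densities and weighted by \<open>g\<close>.\<close>

lemma relative_entropy_le_integral_llr:
  assumes m: "m < M" "m' < M" "m \<noteq> m'" and g: "unit_fun g"
  shows "(\<integral>x. g x \<partial>P m) * ln ((\<integral>x. g x \<partial>P m) / (\<integral>x. g x \<partial>P m')) \<le> (\<integral>x. g x * llr m m' x \<partial>P m)"
proof -
  define \<alpha> where "\<alpha> = (\<integral>x. g x \<partial>P m)"
  define \<beta> where "\<beta> = (\<integral>x. g x \<partial>P m')"
  have [measurable]: "g \<in> borel_measurable mu" using g by (simp add: unit_fun_def)
  note [measurable] = f_measurable[OF m(1)] f_measurable[OF m(2)]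
  have dint: "(\<integral>x. k x \<partial>P j) = (\<integral>x. f j x * k x \<partial>mu)"
    "integrable (P j) k \<longleftrightarrow> integrable mu (\<lambda>x. f j x * k x)"
    if "j < M" "k \<in> borel_measurable mu" for j and k :: "'a \<Rightarrow> real"
    using that unfolding Pm_def
    by (auto simp: integral_density integrable_density f_nonneg)
  show ?thesis
  proof (cases "\<alpha> = 0")
    case True
    then have "AE x in P m. g x = 0"
      using m g unit_fun_integrable[OF m(1) g] unfolding \<alpha>_def
      by (subst (asm) integral_nonneg_eq_0_iff_AE) (auto simp: unit_fun_def)
    then have "(\<integral>x. g x * llr m m' x \<partial>P m) = 0"
      by (intro integral_eq_zero_AE) auto
    with True show ?thesis by (simp add: \<alpha>_def)
  next
    case False
    then have pos: "0 < \<alpha>" "0 < \<beta>"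
      using unit_fun_integral_bounds[OF m(1) g] unit_fun_integral_bounds[OF m(2) g]
        integral_eq_0_transfer[OF m(1,2) g] by (auto simp: \<alpha>_def \<beta>_def less_le)
    have i1: "integrable mu (\<lambda>x. f m x * g x)" "integrable mu (\<lambda>x. f m' x * g x)"
      using unit_fun_integrable[OF m(1) g] unit_fun_integrable[OF m(2) g] m
      by (simp_all add: dint)
    have i2: "integrable mu (\<lambda>x. f m x * (g x * llr m m' x))"
      using integrable_llr[OF m g] m by (simp add: dint)
    \<comment> \<open>The two added terms cancel; with them the right side is the integral of the
      tangent plane at (\<alpha>, \<beta>).\<close>
    have "\<alpha> * ln (\<alpha> / \<beta>) = \<alpha> * ln (\<alpha> / \<beta>) + \<alpha> - \<beta> * (\<alpha> / \<beta>)"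
      using pos by simp
    also have "\<dots> = (\<integral>x. (f m x * g x) * ln (\<alpha> / \<beta>) + f m x * g x - (f m' x * g x) * (\<alpha> / \<beta>) \<partial>mu)"
      using i1 m by (simp add: \<alpha>_def \<beta>_def dint)
    also have "\<dots> \<le> (\<integral>x. f m x * (g x * llr m m' x) \<partial>mu)"
    proof (rule integral_mono_AE)
      have "AE x in mu. 0 < f m x \<longrightarrow> 0 < f m' x"
        using KL[of m m'] m by (simp add: AE_P_iff)
      then show "AE x in mu. (f m x * g x) * ln (\<alpha> / \<beta>) + f m x * g x - (f m' x * g x) * (\<alpha> / \<beta>)
          \<le> f m x * (g x * llr m m' x)"
      proof (rule AE_mp, intro AE_I2 impI)
        fix x assume x: "x \<in> space mu" "0 < f m x \<longrightarrow> 0 < f m' x"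
        have fx: "0 \<le> f m x" "0 \<le> f m' x" "0 \<le> g x"
          using x m g by (auto simp: f_nonneg unit_fun_def)
        have "f m x * ln (\<alpha> / \<beta>) + f m x - f m' x * (\<alpha> / \<beta>) \<le> f m x * ln (f m x / f m' x)"
          using x fx pos by (intro relative_entropy_tangent) auto
        from mult_left_mono[OF this fx(3)]
        show "(f m x * g x) * ln (\<alpha> / \<beta>) + f m x * g x - (f m' x * g x) * (\<alpha> / \<beta>)
          \<le> f m x * (g x * llr m m' x)" by (simp add: algebra_simps)
      qed
    qed (use i1 i2 in auto)
    also have "\<dots> = (\<integral>x. g x * llr m m' x \<partial>P m)" using m by (simp add: dint)
    finally show ?thesis by (simp add: \<alpha>_def \<beta>_def)
  qed
qed

text \<open>Split at a level \<open>K\<close>: the part of the log-likelihood ratio above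
  \<open>K\<close> has small integral whatever \<open>g n\<close> is, and the rest is at most
  \<open>K\<close> times the mean of \<open>g n\<close>.\<close>

lemma uniformly_integrable_llr:
  assumes m: "m < M" "m' < M" "m \<noteq> m'" and g: "\<And>n. unit_fun (g n)"
    and lim: "(\<lambda>n. \<integral>x. g n x \<partial>P m) \<longlonglongrightarrow> 0"
  shows "(\<lambda>n. \<integral>x. g n x * \<bar>llr m m' x\<bar> \<partial>P m) \<longlonglongrightarrow> 0"
proof (rule LIMSEQ_I)
  fix e :: real assume e: "0 < e"
  note [measurable] = f_measurable[OF m(1)] f_measurable[OF m(2)]
  have iL: "integrable (P m) (\<lambda>x. \<bar>llr m m' x\<bar>)" using KL m by auto
  define T where "T K x = \<bar>llr m m' x\<bar> * indicator {x. real K < \<bar>llr m m' x\<bar>} x" for K :: nat and x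
  have iT: "integrable (P m) (T K)" for K
    unfolding T_def by (rule Bochner_Integration.integrable_bound[OF iL]) (auto simp: indicator_def)
  have "(\<lambda>K. \<integral>x. T K x \<partial>P m) \<longlonglongrightarrow> (\<integral>x. 0 \<partial>P m)"
  proof (rule integral_dominated_convergence[where w = "\<lambda>x. \<bar>llr m m' x\<bar>"])
    show "AE x in P m. (\<lambda>K. T K x) \<longlonglongrightarrow> 0"
    proof (intro AE_I2 tendsto_eventually)
      fix x
      obtain N :: nat where "\<bar>llr m m' x\<bar> \<le> real N" using real_arch_simple by blast
      then show "\<forall>\<^sub>F K in sequentially. T K x = 0"
        by (intro eventually_sequentiallyI[of N]) (auto simp: T_def indicator_def)
    qed
  qed (use iL iT in \<open>auto simp: T_def indicator_def\<close>)
  then have "(\<lambda>K. \<integral>x. T K x \<partial>P m) \<longlonglongrightarrow> 0" by simp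
  then obtain K where K: "(\<integral>x. T K x \<partial>P m) < e / 2"
    using order_tendstoD(2)[of _ 0 sequentially "e/2"] e
    by (metis eventually_sequentially half_gt_zero order_refl)
  have "(\<lambda>n. real K * (\<integral>x. g n x \<partial>P m)) \<longlonglongrightarrow> real K * 0"
    by (intro tendsto_intros lim)
  then obtain N where N: "\<And>n. n \<ge> N \<Longrightarrow> real K * (\<integral>x. g n x \<partial>P m) < e / 2"
    using order_tendstoD(2)[of _ 0 sequentially "e/2"] e
    by (auto simp: eventually_sequentially)
  show "\<exists>N. \<forall>n\<ge>N. norm ((\<integral>x. g n x * \<bar>llr m m' x\<bar> \<partial>P m) - 0) < e"
  proof (intro exI[of _ N] allI impI)
    fix n assume n: "n \<ge> N"
    have gi: "integrable (P m) (g n)" by (rule unit_fun_integrable[OF m(1) g])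
    have i1: "integrable (P m) (\<lambda>x. g n x * \<bar>llr m m' x\<bar>)"
      using integrable_abs[OF integrable_llr[OF m g[of n]]]
      by (rule Bochner_Integration.integrable_bound)
         (use g[of n] in \<open>auto simp: unit_fun_def abs_mult\<close>)
    have "(\<integral>x. g n x * \<bar>llr m m' x\<bar> \<partial>P m) \<le> (\<integral>x. real K * g n x + T K x \<partial>P m)"
    proof (rule integral_mono)
      fix x assume "x \<in> space (P m)"
      then have gx: "0 \<le> g n x" "g n x \<le> 1" using g[of n] by (auto simp: unit_fun_def)
      show "g n x * \<bar>llr m m' x\<bar> \<le> real K * g n x + T K x"
      proof (cases "real K < \<bar>llr m m' x\<bar>")
        case True
        then show ?thesis using gx mult_right_mono[OF gx(2), of "\<bar>llr m m' x\<bar>"]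
          by (auto simp: T_def intro: add_increasing)
      next
        case False
        then show ?thesis using gx mult_left_mono[of "\<bar>llr m m' x\<bar>" "real K" "g n x"]
          by (auto simp: T_def mult.commute)
      qed
    qed (use i1 gi iT in auto)
    also have "\<dots> = real K * (\<integral>x. g n x \<partial>P m) + (\<integral>x. T K x \<partial>P m)" using gi iT by simp
    also have "\<dots> < e" using N[OF n] K by simp
    finally have "(\<integral>x. g n x * \<bar>llr m m' x\<bar> \<partial>P m) < e" .
    moreover have "0 \<le> (\<integral>x. g n x * \<bar>llr m m' x\<bar> \<partial>P m)"
      using g[of n] by (intro integral_nonneg_AE) (auto simp: unit_fun_def)
    ultimately show "norm ((\<integral>x. g n x * \<bar>llr m m' x\<bar> \<partial>P m) - 0) < e" by simp
  qed
qed

text \<open>Only the boundary needs care. For \<open>a = 0\<close> the value is squeezed between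
  tangent planes and the vanishing integral of the previous lemma. The case \<open>a > 0\<close>,
  \<open>b = 0\<close> is contradictory, because the values would be unbounded while data processing
  bounds them.\<close>

lemma relative_entropy_tendsto:
  assumes m: "m < M" "m' < M" "m \<noteq> m'" and g: "\<And>n. unit_fun (g n)"
    and a: "(\<lambda>n. \<integral>x. g n x \<partial>P m) \<longlonglongrightarrow> a" and b: "(\<lambda>n. \<integral>x. g n x \<partial>P m') \<longlonglongrightarrow> b"
  shows "(\<lambda>n. (\<integral>x. g n x \<partial>P m) * ln ((\<integral>x. g n x \<partial>P m) / (\<integral>x. g n x \<partial>P m'))) \<longlonglongrightarrow> a * ln (a / b)"
proof -
  let ?a = "\<lambda>n. \<integral>x. g n x \<partial>P m" and ?b = "\<lambda>n. \<integral>x. g n x \<partial>P m'"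
  let ?h = "\<lambda>n. ?a n * ln (?a n / ?b n)"
  have a0: "0 \<le> ?a n" and b0: "0 \<le> ?b n" for n
    using unit_fun_integral_bounds g m by auto
  have ab: "?b n = 0 \<Longrightarrow> ?a n = 0" for n using integral_eq_0_transfer[OF m(1,2) g] by auto
  have "0 \<le> a" "0 \<le> b"
    using LIMSEQ_le_const[OF a] LIMSEQ_le_const[OF b] a0 b0 by auto
  have upper: "?h n \<le> (\<integral>x. g n x * \<bar>llr m m' x\<bar> \<partial>P m)" for n
  proof -
    have "?h n \<le> (\<integral>x. g n x * llr m m' x \<partial>P m)"
      by (rule relative_entropy_le_integral_llr[OF m g])
    also have "\<dots> \<le> (\<integral>x. \<bar>g n x * llr m m' x\<bar> \<partial>P m)"
      by (intro integral_mono integrable_abs integrable_llr[OF m g]) auto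
    also have "\<dots> = (\<integral>x. g n x * \<bar>llr m m' x\<bar> \<partial>P m)"
      using g[of n] by (intro Bochner_Integration.integral_cong) (auto simp: unit_fun_def abs_mult)
    finally show ?thesis .
  qed
  have lower: "?a n * ln c + ?a n - ?b n * c \<le> ?h n" if "0 < c" for c n
    using relative_entropy_tangent[OF a0 b0 ab, where \<alpha>=c and \<beta>=1] that by simp
  consider "a = 0" | "a > 0" "b = 0" | "a > 0" "b > 0"
    using \<open>0 \<le> a\<close> \<open>0 \<le> b\<close> by force
  then show ?thesis
  proof cases
    case 1
    have U: "(\<lambda>n. \<integral>x. g n x * \<bar>llr m m' x\<bar> \<partial>P m) \<longlonglongrightarrow> 0"
      using uniformly_integrable_llr[OF m g] a 1 by simp
    have "?h \<longlonglongrightarrow> 0"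
    proof (rule order_tendstoI)
      fix y :: real assume "0 < y"
      from order_tendstoD(2)[OF U this] show "\<forall>\<^sub>F n in sequentially. ?h n < y"
        by (rule eventually_mono) (rule le_less_trans[OF upper])
    next
      fix y :: real assume y: "y < 0"
      \<comment> \<open>Small enough that the limit \<open>- (b * c)\<close> of the tangent bound
        stays above \<open>y\<close>.\<close>
      define c where "c = - y / (2 * (b + 1))"
      have c: "0 < c" using y \<open>0 \<le> b\<close> unfolding c_def by (intro divide_pos_pos) auto
      have "y * (b + 2) < 0" using y \<open>0 \<le> b\<close> by (intro mult_neg_pos) auto
      then have "y < - (b * c)" using \<open>0 \<le> b\<close> by (simp add: c_def field_simps)
      moreover have "(\<lambda>n. ?a n * ln c + ?a n - ?b n * c) \<longlonglongrightarrow> a * ln c + a - b * c"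
        by (intro tendsto_intros a b)
      ultimately have "\<forall>\<^sub>F n in sequentially. y < ?a n * ln c + ?a n - ?b n * c"
        using 1 by (intro order_tendstoD(1)) auto
      then show "\<forall>\<^sub>F n in sequentially. y < ?h n"
        by (rule eventually_mono) (rule less_le_trans[OF _ lower[OF c]])
    qed
    then show ?thesis using 1 by simp
  next
    case 2
    define B where "B = (\<integral>x. \<bar>llr m m' x\<bar> \<partial>P m)"
    have hB: "?h n \<le> B" for n
      using upper[of n]
    proof (rule order_trans)
      have "integrable (P m) (llr m m')" using KL m by auto
      then show "(\<integral>x. g n x * \<bar>llr m m' x\<bar> \<partial>P m) \<le> B"
        unfolding B_def using g[of n]
        by (intro integral_mono') (auto simp: unit_fun_def intro!: mult_left_le_one_le)
    qed
    \<comment> \<open>With this slope and \<open>b = 0\<close> the tangent bound has the limit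
      \<open>B + a\<close>, which exceeds the upper bound \<open>B\<close>.\<close>
    define c where "c = exp (B / a)"
    have "(\<lambda>n. ?a n * ln c + ?a n - ?b n * c) \<longlonglongrightarrow> a * ln c + a - b * c"
      by (intro tendsto_intros a b)
    then have "a * ln c + a - b * c \<le> B"
      by (rule LIMSEQ_le_const2) (intro exI[of _ 0] allI impI order_trans[OF lower hB], simp add: c_def)
    then show ?thesis using 2 by (simp add: c_def)
  next
    case 3
    then show ?thesis by (intro tendsto_intros a b) auto
  qed
qed

section \<open>Information numbers of quantizers and of their mixtures\<close>

abbreviation D :: "('a \<Rightarrow> nat) set" where "D \<equiv> {phi. det_quantizer mu l phi}"

abbreviation q :: "nat \<Rightarrow> ('a \<Rightarrow> nat) \<Rightarrow> nat \<Rightarrow> real" where "q \<equiv> qpmf mu f"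

abbreviation Id :: "nat \<Rightarrow> nat \<Rightarrow> ('a \<Rightarrow> nat) \<Rightarrow> real" where "Id \<equiv> Idet mu f l"

lemma D_vimage [measurable]: "phi \<in> D \<Longrightarrow> phi -` S \<inter> space mu \<in> sets mu"
  by (auto simp: det_quantizer_def intro: measurable_sets)

lemma qpmf_eq_integral:
  "phi \<in> D \<Longrightarrow> q m phi u = (\<integral>x. indicator (phi -` {u} \<inter> space mu) x \<partial>P m)"
  by (simp add: qpmf_def Int_absorb2)

lemma unit_fun_indicator: "B \<in> sets mu \<Longrightarrow> unit_fun (indicator B)"
  by (auto simp: unit_fun_def indicator_def)

lemma qpmf_bounds:
  assumes "m < M"
  shows "0 \<le> q m phi u" "q m phi u \<le> 1"
proof -
  interpret prob_space "P m" by (rule prob_space_P[OF assms])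
  show "0 \<le> q m phi u" "q m phi u \<le> 1" by (auto simp: qpmf_def)
qed

lemma sum_qpmf:
  assumes "m < M" "phi \<in> D"
  shows "(\<Sum>u<l. q m phi u) = 1"
proof -
  interpret prob_space "P m" by (rule prob_space_P[OF assms(1)])
  have "(\<Sum>u<l. q m phi u) = prob (\<Union>u<l. phi -` {u} \<inter> space mu)"
    unfolding qpmf_def using assms
    by (intro finite_measure_finite_Union[symmetric]) (auto simp: disjoint_family_on_def)
  also have "(\<Union>u<l. phi -` {u} \<inter> space mu) = space (P m)"
    using assms by (auto simp: det_quantizer_def)
  finally show ?thesis by (simp only: prob_space)
qed

lemma qpmf_eq_0_transfer:
  "m < M \<Longrightarrow> m' < M \<Longrightarrow> phi \<in> D \<Longrightarrow> q m' phi u = 0 \<Longrightarrow> q m phi u = 0"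
  using integral_eq_0_transfer[of m m' "indicator (phi -` {u} \<inter> space mu)"]
  by (simp add: qpmf_eq_integral unit_fun_indicator del: Bochner_Integration.integral_indicator)

text \<open>Convexity, message by message. The left side is the divergence of the averaged message
  distributions, that is, of the message when the random choice of quantizer is not
  revealed.\<close>

lemma Idet_mixture_ge:
  assumes "m < M" "m' < M" "mixture D n W \<Phi>"
  shows "(\<Sum>u<l. avg n W \<Phi> (\<lambda>phi. q m phi u)
            * ln (avg n W \<Phi> (\<lambda>phi. q m phi u) / avg n W \<Phi> (\<lambda>phi. q m' phi u)))
         \<le> avg n W \<Phi> (Id m m')"
proof -
  have "(\<Sum>u<l. avg n W \<Phi> (\<lambda>phi. q m phi u)
            * ln (avg n W \<Phi> (\<lambda>phi. q m phi u) / avg n W \<Phi> (\<lambda>phi. q m' phi u)))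
       \<le> (\<Sum>u<l. \<Sum>i<n. W i * (q m (\<Phi> i) u * ln (q m (\<Phi> i) u / q m' (\<Phi> i) u)))"
    using assms qpmf_eq_0_transfer[OF assms(1,2)]
    by (intro sum_mono log_sum_inequality) (auto simp: mixture_def qpmf_bounds)
  also have "\<dots> = avg n W \<Phi> (Id m m')"
    unfolding Idet_def sum_distrib_left by (rule sum.swap)
  finally show ?thesis .
qed

text \<open>For each message the averaged probabilities under all states are integrals of one common
  \<open>unit_fun\<close>, so continuity applies to mixtures as well, even with a varying number of
  components.\<close>

lemma Idet_mixture_tendsto:
  fixes n :: "nat \<Rightarrow> nat"
  assumes m: "m < M" "m' < M" "m \<noteq> m'" and mix: "\<And>s. mixture D (n s) (W s) (\<Phi> s)"
    and a: "\<And>u. u < l \<Longrightarrow> (\<lambda>s. avg (n s) (W s) (\<Phi> s) (\<lambda>phi. q m phi u)) \<longlonglongrightarrow> a u"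
    and b: "\<And>u. u < l \<Longrightarrow> (\<lambda>s. avg (n s) (W s) (\<Phi> s) (\<lambda>phi. q m' phi u)) \<longlonglongrightarrow> b u"
  shows "(\<lambda>s. \<Sum>u<l. avg (n s) (W s) (\<Phi> s) (\<lambda>phi. q m phi u)
            * ln (avg (n s) (W s) (\<Phi> s) (\<lambda>phi. q m phi u) / avg (n s) (W s) (\<Phi> s) (\<lambda>phi. q m' phi u)))
         \<longlonglongrightarrow> (\<Sum>u<l. a u * ln (a u / b u))"
proof (rule tendsto_sum)
  fix u assume "u \<in> {..<l}"
  then have u: "u < l" by simp
  define g where "g s x = (\<Sum>i<n s. W s i * indicator (\<Phi> s i -` {u} \<inter> space mu) x)" for s x
  have g: "unit_fun (g s)" for s
    unfolding unit_fun_def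
  proof (intro conjI ballI)
    show "g s \<in> borel_measurable mu"
      using mix[of s] unfolding g_def
      by (intro borel_measurable_sum borel_measurable_times borel_measurable_indicator D_vimage)
         (auto simp: mixture_def)
    fix x
    show "0 \<le> g s x" using mix[of s] by (auto simp: g_def mixture_def intro!: sum_nonneg)
    have "g s x \<le> (\<Sum>i<n s. W s i)"
      unfolding g_def using mix[of s] by (intro sum_mono) (auto simp: mixture_def indicator_def)
    then show "g s x \<le> 1" using mix[of s] by (simp add: mixture_def)
  qed
  have eq: "(\<integral>x. g s x \<partial>P k) = avg (n s) (W s) (\<Phi> s) (\<lambda>phi. q k phi u)" if "k < M" for k s
  proof -
    have "integrable (P k) (indicator (\<Phi> s i -` {u} \<inter> space mu) :: 'a \<Rightarrow> real)" if "i < n s" for i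
      using mix[of s] that \<open>k < M\<close>
      by (intro unit_fun_integrable unit_fun_indicator D_vimage) (auto simp: mixture_def)
    then have "(\<integral>x. g s x \<partial>P k)
        = (\<Sum>i<n s. W s i * (\<integral>x. indicator (\<Phi> s i -` {u} \<inter> space mu) x \<partial>P k))"
      unfolding g_def
      by (subst Bochner_Integration.integral_sum) (auto simp del: Bochner_Integration.integral_indicator)
    also have "\<dots> = avg (n s) (W s) (\<Phi> s) (\<lambda>phi. q k phi u)"
      using mix[of s] by (intro sum.cong refl) (auto simp: mixture_def qpmf_eq_integral)
    finally show ?thesis .
  qed
  show "(\<lambda>s. avg (n s) (W s) (\<Phi> s) (\<lambda>phi. q m phi u)
            * ln (avg (n s) (W s) (\<Phi> s) (\<lambda>phi. q m phi u) / avg (n s) (W s) (\<Phi> s) (\<lambda>phi. q m' phi u)))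
         \<longlonglongrightarrow> a u * ln (a u / b u)"
    using relative_entropy_tendsto[OF m g, where a = "a u" and b = "b u"] a[OF u] b[OF u] m by (simp add: eq)
qed

lemma Idet_tendsto:
  assumes m: "m < M" "m' < M" "m \<noteq> m'" and D: "\<And>s. \<Phi> s \<in> D"
    and a: "\<And>u. u < l \<Longrightarrow> (\<lambda>s. q m (\<Phi> s) u) \<longlonglongrightarrow> a u"
    and b: "\<And>u. u < l \<Longrightarrow> (\<lambda>s. q m' (\<Phi> s) u) \<longlonglongrightarrow> b u"
  shows "(\<lambda>s. Id m m' (\<Phi> s)) \<longlonglongrightarrow> (\<Sum>u<l. a u * ln (a u / b u))"
  using Idet_mixture_tendsto[of m m' "\<lambda>_. 1" "\<lambda>_ _. 1" "\<lambda>s _. \<Phi> s" a b] assms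
  by (simp add: mixture_def Idet_def)

text \<open>Gibbs' inequality: the tangent plane at (1, 1) gives the lower bound
  \<open>a - b\<close>, and these differences sum to 0 over the messages.\<close>

lemma Idet_nonneg:
  assumes "m < M" "m' < M" "phi \<in> D"
  shows "0 \<le> Id m m' phi"
proof -
  have "0 = (\<Sum>u<l. q m phi u - q m' phi u)"
    using sum_qpmf assms by (simp add: sum_subtractf)
  also have "\<dots> \<le> Id m m' phi"
    unfolding Idet_def
  proof (rule sum_mono)
    fix u
    show "q m phi u - q m' phi u \<le> q m phi u * ln (q m phi u / q m' phi u)"
      using relative_entropy_tangent[of "q m phi u" "q m' phi u" 1 1]
        qpmf_eq_0_transfer[OF assms] assms by (auto simp: qpmf_bounds)
  qed
  finally show ?thesis .
qed

text \<open>A bound uniform in the quantizer. It makes the supremum \<open>Imax\<close> meaningful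
  and lets components with vanishing weight disappear in the limit.\<close>

lemma Idet_bounded:
  assumes m: "m < M"
  obtains C where "\<And>m' phi. m' < M \<Longrightarrow> m' \<noteq> m \<Longrightarrow> phi \<in> D \<Longrightarrow> Id m m' phi \<le> C"
proof -
  define c where "c m' = real l * (\<integral>x. \<bar>llr m m' x\<bar> \<partial>P m)" for m'
  have "Id m m' phi \<le> c m'" if "m' < M" "m' \<noteq> m" "phi \<in> D" for m' phi
  proof -
    have "q m phi u * ln (q m phi u / q m' phi u) \<le> (\<integral>x. \<bar>llr m m' x\<bar> \<partial>P m)" for u
    proof -
      let ?g = "indicator (phi -` {u} \<inter> space mu) :: 'a \<Rightarrow> real"
      have g: "unit_fun ?g" using that by (intro unit_fun_indicator) auto
      have "q m phi u * ln (q m phi u / q m' phi u) \<le> (\<integral>x. ?g x * llr m m' x \<partial>P m)"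
        using relative_entropy_le_integral_llr[OF m that(1) that(2)[symmetric] g] that
        by (simp add: qpmf_eq_integral)
      also have "\<dots> \<le> (\<integral>x. \<bar>llr m m' x\<bar> \<partial>P m)"
        using integrable_llr[OF m that(1) that(2)[symmetric] g] KL[OF m that(1) that(2)[symmetric]]
        by (intro integral_mono) (auto simp: indicator_def)
      finally show ?thesis .
    qed
    then have "Id m m' phi \<le> (\<Sum>u<l. \<integral>x. \<bar>llr m m' x\<bar> \<partial>P m)"
      unfolding Idet_def by (intro sum_mono)
    then show ?thesis by (simp add: c_def)
  qed
  moreover have "c m' \<le> (\<Sum>k<M. c k)" if "m' < M" for m'
    using that by (intro member_le_sum) (auto simp: c_def)
  ultimately show ?thesis by (intro that[of "\<Sum>k<M. c k"]) (meson order_trans)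
qed

lemma le_Imin_iff: "m < M \<Longrightarrow> c \<le> Imin mu f M l m p \<longleftrightarrow> (\<forall>m'<M. m' \<noteq> m \<longrightarrow> c \<le> Irand mu f l m m' p)"
proof -
  have "card ({..<M} - {m}) > 0" if "m < M" using M2 that by simp
  then have "{..<M} - {m} \<noteq> {}" if "m < M" using that by fastforce
  then show "m < M \<Longrightarrow> ?thesis" by (auto simp: Imin_def Min_ge_iff)
qed

text \<open>A real supremum dominates the members of a family only if the family is bounded above;
  the bound on the information against one other state, available as \<open>M >= 2\<close>, gives
  this.\<close>

lemma Imin_le_Imax:
  assumes m: "m < M" and p: "quantizer mu l p"
  shows "Imin mu f M l m p \<le> Imax mu f M l m"
  unfolding Imax_def
proof (rule cSUP_upper)
  obtain C where C: "\<And>m' phi. m' < M \<Longrightarrow> m' \<noteq> m \<Longrightarrow> phi \<in> D \<Longrightarrow> Id m m' phi \<le> C"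
    using Idet_bounded[OF m] by blast
  define m' where "m' = (if m = 0 then 1 else 0 :: nat)"
  have m': "m' < M" "m' \<noteq> m" using M2 by (auto simp: m'_def)
  have "Imin mu f M l m p \<le> C" if "quantizer mu l p" for p
  proof -
    have pD: "phi \<in> D" if "phi \<in> set_pmf p" for phi using that \<open>quantizer mu l p\<close> by (auto simp: quantizer_def)
    have "Irand mu f l m m' p \<le> C" unfolding Irand_def
      using C[OF m'] Idet_nonneg[OF m m'(1)] pD
      by (intro measure_pmf.integral_le_const measure_pmf.integrable_const_bound[where B=C])
         (fastforce simp: AE_measure_pmf_iff)+
    then show ?thesis using le_Imin_iff[OF m, of "Imin mu f M l m p" p] m' by auto
  qed
  then show "bdd_above ((Imin mu f M l m) ` {p. quantizer mu l p})"
    by (intro bdd_aboveI2) auto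
qed (use p in auto)

lemma det_quantizer_const: "(\<lambda>_. 0) \<in> D"
  using l2 by (auto simp: det_quantizer_def)

text \<open>Half of \<open>e\<close> pays for approaching the supremum, half for truncating a
  countable randomization to a finite one.\<close>

lemma approximately_maximin_mixture:
  assumes m: "m < M" and "0 < e"
  obtains n W \<Phi> where "mixture D n W \<Phi>"
    "\<And>m'. m' < M \<Longrightarrow> m' \<noteq> m \<Longrightarrow> Imax mu f M l m - e \<le> avg n W \<Phi> (Id m m')"
proof -
  have "quantizer mu l (return_pmf (\<lambda>_. 0))" using det_quantizer_const by (simp add: quantizer_def)
  then have ne: "{p. quantizer mu l p} \<noteq> {}" by blast
  have "\<exists>p. quantizer mu l p \<and> Imax mu f M l m - e / 2 \<le> Imin mu f M l m p"
  proof (rule ccontr)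
    assume *: "\<not> ?thesis"
    have "Imax mu f M l m \<le> Imax mu f M l m - e / 2"
      using * unfolding Imax_def[of mu f M l m] by (intro cSUP_least ne) (force simp: Imax_def)
    then show False using assms by simp
  qed
  then obtain p where p: "quantizer mu l p" "Imax mu f M l m - e / 2 \<le> Imin mu f M l m p" by auto
  obtain C where C: "\<And>m' phi. m' < M \<Longrightarrow> m' \<noteq> m \<Longrightarrow> phi \<in> D \<Longrightarrow> Id m m' phi \<le> C"
    using Idet_bounded[OF m] by blast
  have pD: "set_pmf p \<subseteq> D" using p by (simp add: quantizer_def)
  let ?J = "{..<M} - {m}"
  have bd: "0 \<le> Id m j a \<and> Id m j a \<le> C" if "j \<in> ?J" "a \<in> set_pmf p" for j a
    using that pD C[of j a] Idet_nonneg[OF m, of j a] by auto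
  obtain A w where A: "finite A" "A \<subseteq> set_pmf p" "\<And>a. a \<in> A \<Longrightarrow> 0 \<le> w a" "sum w A = 1"
    "\<And>j. j \<in> ?J \<Longrightarrow> measure_pmf.expectation p (Id m j) - e / 2 \<le> (\<Sum>a\<in>A. w a * Id m j a)"
    using pmf_truncation[where v="Id m" and J="?J" and e="e/2", OF bd] assms by auto
  obtain g where g: "bij_betw g {..<card A} A"
    using A(1) ex_bij_betw_nat_finite atLeast0LessThan by metis
  have sum: "(\<Sum>i<card A. h (g i)) = sum h A" for h :: "_ \<Rightarrow> real"
    by (rule sum.reindex_bij_betw[OF g])
  show ?thesis
  proof (rule that[of "card A" "\<lambda>i. w (g i)" g])
    show "mixture D (card A) (\<lambda>i. w (g i)) g"
      using A pD bij_betwE[OF g] sum[of w] by (auto simp: mixture_def)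
    show "Imax mu f M l m - e \<le> avg (card A) (\<lambda>i. w (g i)) g (Id m m')" if m': "m' < M" "m' \<noteq> m" for m'
    proof -
      have "Imax mu f M l m - e / 2 \<le> measure_pmf.expectation p (Id m m')"
        using p le_Imin_iff[OF m] m' by (auto simp: Irand_def)
      then show ?thesis using A(5)[of m'] m' sum[of "\<lambda>a. w a * Id m m' a"] by simp
    qed
  qed
qed

subsection \<open>Approximation by ULQs\<close>

abbreviation U :: "('a \<Rightarrow> nat) set" where "U \<equiv> {phi. ULQ mu f M l phi}"

lemma U_subset_D: "U \<subseteq> D"
  by (auto simp: ULQ_def)

lemma f_integrable: "m < M \<Longrightarrow> integrable mu (f m)"
  using dens[of m] by (intro integrableI_nonneg) auto

text \<open>As an integral over \<open>mu\<close>, a linear functional of the message probabilities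
  can be minimized separately at each observation.\<close>

lemma linear_cost_eq_integral:
  fixes a :: "nat \<Rightarrow> nat \<Rightarrow> real"
  assumes phi: "phi \<in> D"
  shows "(\<Sum>m<M. \<Sum>u<l. a u m * q m phi u) = (\<integral>x. (\<Sum>m<M. a (phi x) m * f m x) \<partial>mu)"
    and "integrable mu (\<lambda>x. \<Sum>m<M. a (phi x) m * f m x)"
proof -
  have int: "integrable mu (\<lambda>x. f m x * indicator (phi -` {u} \<inter> space mu) x)" if "m < M" for m u
    using f_integrable[OF that] phi by (intro integrable_real_mult_indicator D_vimage) auto
  have q: "q m phi u = (\<integral>x. f m x * indicator (phi -` {u} \<inter> space mu) x \<partial>mu)" if "m < M" for m u
    unfolding qpmf_eq_integral[OF phi] Pm_def using that phi
    by (subst integral_density) (auto simp: f_nonneg)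
  have eq: "a (phi x) m * f m x = (\<Sum>u<l. a u m * (f m x * indicator (phi -` {u} \<inter> space mu) x))"
    if "x \<in> space mu" for x m
  proof -
    have "phi x < l" using phi that by (auto simp: det_quantizer_def)
    then have "(\<Sum>u<l. a u m * (f m x * indicator (phi -` {u} \<inter> space mu) x))
       = (\<Sum>u<l. if u = phi x then a u m * f m x else 0)"
      using that by (intro sum.cong) (auto simp: indicator_def)
    then show ?thesis using \<open>phi x < l\<close> by simp
  qed
  show "integrable mu (\<lambda>x. \<Sum>m<M. a (phi x) m * f m x)"
    using int by (subst Bochner_Integration.integrable_cong[OF refl sum.cong[OF refl eq]]) auto
  have "(\<integral>x. (\<Sum>m<M. a (phi x) m * f m x) \<partial>mu)
      = (\<integral>x. (\<Sum>m<M. \<Sum>u<l. a u m * (f m x * indicator (phi -` {u} \<inter> space mu) x)) \<partial>mu)"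
    by (intro Bochner_Integration.integral_cong refl sum.cong eq)
  also have "\<dots> = (\<Sum>m<M. \<Sum>u<l. a u m * q m phi u)"
    using int by (simp add: q)
  finally show "(\<Sum>m<M. \<Sum>u<l. a u m * q m phi u) = (\<integral>x. (\<Sum>m<M. a (phi x) m * f m x) \<partial>mu)" ..
qed

text \<open>Ties between two cost functions are broken by adding t times the index of the message to all
  costs: for each pair of messages and each x with positive densities only one t produces a tie, so
  all but countably many t give ties of probability zero.\<close>
lemma approximately_optimal_ULQ:
  fixes c :: "nat \<Rightarrow> nat \<Rightarrow> real"
  assumes "0 < e"
  obtains psi where "psi \<in> U" "\<And>phi. phi \<in> D \<Longrightarrow>
    (\<Sum>m<M. \<Sum>u<l. c u m * q m psi u) \<le> (\<Sum>m<M. \<Sum>u<l. c u m * q m phi u) + e"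
proof -
  define F where "F x = (\<Sum>m<M. f m x)" for x
  define g where "g i x = (\<Sum>m<M. c i m * f m x)" for i x
  \<comment> \<open>For distinct \<open>i\<close> and \<open>j\<close> and positive
    \<open>F x\<close>, this is the only \<open>t\<close> at which the perturbed costs tie. The
    \<open>bad\<close> values are the atoms of the law of \<open>R i j\<close> under
    \<open>P m\<close>.\<close>
  define R where "R i j x = (g j x - g i x) / ((real i - real j) * F x)" for i j x
  define bad where "bad m i j = {t. measure (P m) {x\<in>space mu. R i j x = t} \<noteq> 0}" for m i j
  have [measurable]: "g i \<in> borel_measurable mu" "F \<in> borel_measurable mu" for i
    unfolding g_def F_def by (auto intro!: borel_measurable_sum)
  have [measurable]: "R i j \<in> borel_measurable mu" for i j unfolding R_def by measurable
  have cb: "countable (bad m i j)" if "m < M" for m i j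
  proof -
    interpret prob_space "P m" by (rule prob_space_P[OF that])
    interpret d: prob_space "distr (P m) borel (R i j)" by (rule prob_space_distr) simp
    have "{x\<in>space mu. R i j x = t} = R i j -` {t} \<inter> space (P m)" for t by auto
    then have "bad m i j = {t. measure (distr (P m) borel (R i j)) {t} \<noteq> 0}"
      unfolding bad_def by (subst measure_distr) auto
    then show ?thesis using d.countable_support by simp
  qed
  \<comment> \<open>The perturbation changes the total cost by at most \<open>t * l * M\<close>,
    which is then at most \<open>e\<close>.\<close>
  define \<delta> where "\<delta> = e / (real l * real M)"
  have \<delta>: "0 < \<delta>" using assms M2 l2 by (simp add: \<delta>_def)
  have "countable (\<Union>m<M. \<Union>i<l. \<Union>j<l. bad m i j)" using cb by auto
  then have "\<not> {0<..<\<delta>} \<subseteq> (\<Union>m<M. \<Union>i<l. \<Union>j<l. bad m i j)"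
    using uncountable_open_interval[of 0 \<delta>] \<delta> countable_subset by auto
  then obtain t where "t \<in> {0<..<\<delta>}" and tb: "t \<notin> (\<Union>m<M. \<Union>i<l. \<Union>j<l. bad m i j)" by blast
  then have t: "0 < t" "t < \<delta>" by auto
  have t_bad: "t \<notin> bad m i j" if "m < M" "i < l" "j < l" for m i j using tb that by blast
  define a where "a i m = c i m + t * real i" for i m :: nat
  define G where "G i x = (\<Sum>m<M. a i m * f m x)" for i x
  have G: "G i x = g i x + t * real i * F x" for i x
    unfolding G_def a_def g_def F_def sum_distrib_left by (simp add: algebra_simps sum.distrib)
  have [measurable]: "G i \<in> borel_measurable mu" for i unfolding G by measurable
  \<comment> \<open>Choosing the least minimizing index makes the minimizer measurable.\<close>
  define psi where "psi x = (LEAST i. i < l \<and> (\<forall>j<l. G i x \<le> G j x))" for x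
  have psi: "psi x < l \<and> (\<forall>j<l. G (psi x) x \<le> G j x)" for x
  proof -
    have "finite ((\<lambda>i. G i x) ` {..<l})" "(\<lambda>i. G i x) ` {..<l} \<noteq> {}"
      using l2 by (auto simp: lessThan_empty_iff)
    from Min_in[OF this] obtain i where "i < l" "Min ((\<lambda>i. G i x) ` {..<l}) = G i x" by auto
    then have "i < l \<and> (\<forall>j<l. G i x \<le> G j x)" by (metis Min_le finite_imageI finite_lessThan imageI lessThan_iff)
    then show ?thesis unfolding psi_def by (rule LeastI)
  qed
  have "psi \<in> measurable mu (count_space UNIV)" unfolding psi_def by measurable
  then have psiD: "psi \<in> D" using psi by (auto simp: det_quantizer_def)
  have tie: "emeasure (P m) {x\<in>space mu. \<exists>i<l. \<exists>j<l. i \<noteq> j \<and> G i x = G j x \<and> (\<forall>k<l. G i x \<le> G k x)} = 0"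
    if m: "m < M" for m
  proof -
    interpret prob_space "P m" by (rule prob_space_P[OF m])
    define T where "T x \<longleftrightarrow> (\<exists>i<l. \<exists>j<l. i \<noteq> j \<and> G i x = G j x \<and> (\<forall>k<l. G i x \<le> G k x))" for x
    have "{x \<in> space mu. T x} \<in> sets mu" unfolding T_def by measurable
    have ne: "AE x in P m. R i j x \<noteq> t" if "i < l" "j < l" for i j
    proof -
      have "{x \<in> space (P m). \<not> R i j x \<noteq> t} \<in> sets (P m)" by simp
      moreover have "measure (P m) {x\<in>space mu. R i j x = t} = 0"
        using t_bad[OF m that] by (simp add: bad_def)
      ultimately show ?thesis
        by (subst AE_iff_measurable[OF _ refl]) (auto simp: emeasure_eq_measure)
    qed
    have "AE x in P m. \<forall>i\<in>{..<l}. \<forall>j\<in>{..<l}. R i j x \<noteq> t"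
      using ne by (intro AE_finite_allI) auto
    moreover have "AE x in P m. 0 < f m x" using m by (simp add: AE_P_iff)
    moreover have "AE x in P m. x \<in> space mu" by (rule AE_I2) simp
    ultimately have "AE x in P m. \<not> T x"
    proof eventually_elim
      case (elim x)
      have "f m x \<le> F x" unfolding F_def
        using m elim by (intro member_le_sum) (auto simp: f_nonneg)
      then have F: "F x > 0" using elim by simp
      have "G i x \<noteq> G j x" if "i < l" "j < l" "i \<noteq> j" for i j
      proof
        assume "G i x = G j x"
        then have "t * ((real i - real j) * F x) = g j x - g i x" unfolding G by (simp add: algebra_simps)
        then have "R i j x = t" using F that by (simp add: R_def field_simps)
        then show False using elim that by auto
      qed
      then show ?case unfolding T_def by blast
    qed
    then show ?thesis
      using \<open>{x \<in> space mu. T x} \<in> sets mu\<close>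
      by (subst (asm) AE_iff_measurable[OF _ refl]) (auto simp flip: T_def)
  qed
  have "psi \<in> U"
    unfolding mem_Collect_eq ULQ_def Let_def
    using psiD psi tie by (intro conjI exI[of _ a]) (auto simp flip: G_def)
  moreover have "(\<Sum>m<M. \<Sum>u<l. c u m * q m psi u) \<le> (\<Sum>m<M. \<Sum>u<l. c u m * q m phi u) + e"
    if phi: "phi \<in> D" for phi
  proof -
    have "(\<Sum>m<M. \<Sum>u<l. c u m * q m psi u) \<le> (\<Sum>m<M. \<Sum>u<l. a u m * q m psi u)"
      using t by (intro sum_mono mult_right_mono) (auto simp: a_def qpmf_bounds)
    also have "\<dots> = (\<integral>x. G (psi x) x \<partial>mu)"
      unfolding G_def by (rule linear_cost_eq_integral[OF psiD])
    also have "\<dots> \<le> (\<integral>x. G (phi x) x \<partial>mu)"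
      using psi phi linear_cost_eq_integral(2)[OF psiD] linear_cost_eq_integral(2)[OF phi]
      by (intro integral_mono) (auto simp: G_def[abs_def] det_quantizer_def)
    also have "\<dots> = (\<Sum>m<M. \<Sum>u<l. a u m * q m phi u)"
      unfolding G_def by (rule linear_cost_eq_integral(1)[OF phi, symmetric])
    also have "\<dots> = (\<Sum>m<M. \<Sum>u<l. c u m * q m phi u) + (\<Sum>m<M. \<Sum>u<l. t * real u * q m phi u)"
      by (simp add: a_def algebra_simps sum.distrib)
    also have "(\<Sum>m<M. \<Sum>u<l. t * real u * q m phi u) \<le> (\<Sum>m<M. \<Sum>u<l. t * real l * q m phi u)"
      using t by (intro sum_mono mult_right_mono mult_left_mono) (auto simp: qpmf_bounds)
    also have "\<dots> = (\<Sum>m<M. t * real l)"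
      using phi by (intro sum.cong refl) (simp add: sum_qpmf flip: sum_distrib_left)
    also have "\<dots> \<le> e" using t M2 l2 by (simp add: \<delta>_def field_simps)
    finally show ?thesis by simp
  qed
  ultimately show ?thesis using that by blast
qed

text \<open>A Frank-Wolfe step towards the target strictly decreases the distance of a mixture of ULQs to
  it, unless the infimum of these distances vanishes.\<close>
lemma qpmf_approximated_by_ULQ_mixture:
  assumes phi: "phi \<in> D" and "0 < e"
  obtains n W \<Phi> where "mixture U n W \<Phi>"
    "(\<Sum>m<M. \<Sum>u<l. (avg n W \<Phi> (\<lambda>psi. q m psi u) - q m phi u)\<^sup>2) < e"
proof -
  define d where "d n W \<Phi> = (\<Sum>m<M. \<Sum>u<l. (avg n W \<Phi> (\<lambda>psi. q m psi u) - q m phi u)\<^sup>2)" for n W \<Phi>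
  define X where "X = {d n W \<Phi> | n W \<Phi>. mixture U n W \<Phi>}"
  obtain psi0 where "psi0 \<in> U" using approximately_optimal_ULQ[OF \<open>0 < e\<close>] by metis
  then have "mixture U 1 (\<lambda>_. 1) (\<lambda>_. psi0)" by (simp add: mixture_def)
  then have ne: "X \<noteq> {}" by (auto simp: X_def)
  have bdd: "bdd_below X" by (rule bdd_belowI[of _ 0]) (auto simp: X_def d_def intro!: sum_nonneg)
  define \<Delta> where "\<Delta> = Inf X"
  have "\<not> 0 < \<Delta>"
  proof
    assume \<Delta>: "0 < \<Delta>"
    define K where "K = real M * real l"
    have K: "0 < K" using M2 l2 by (simp add: K_def)
    \<comment> \<open>Step length of the Frank-Wolfe move. The quadratic term costs at most
      \<open>\<gamma>\<^sup>2 * K\<close>, hence at most \<open>\<gamma> * \<Delta>\<close>, half of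
      the first-order gain.\<close>
    define \<gamma> where "\<gamma> = min (1/2) (\<Delta> / K)"
    have \<gamma>: "0 < \<gamma>" "\<gamma> \<le> 1/2" "\<gamma> * K \<le> \<Delta>"
      using \<Delta> K by (auto simp: \<gamma>_def min_def field_simps)
    \<comment> \<open>Both the excess of the starting mixture over the infimum and the error of the
      linear minimization, which enters with factor \<open>2 * \<gamma> <= 1\<close>, are at most
      \<eta>. Together they stay below the remaining gain
      \<open>\<gamma> * \<Delta>\<close>.\<close>
    define \<eta> where "\<eta> = \<gamma> * \<Delta> / 4"
    have \<eta>: "0 < \<eta>" using \<gamma> \<Delta> by (simp add: \<eta>_def)
    have "\<exists>y\<in>X. y < \<Delta> + \<eta>"
      using cInf_lessD[OF ne, of "\<Delta> + \<eta>"] \<eta> by (auto simp: \<Delta>_def)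
    then obtain n W \<Phi> where mix: "mixture U n W \<Phi>" and dlt: "d n W \<Phi> < \<Delta> + \<eta>"
      by (auto simp: X_def)
    define x where "x m u = avg n W \<Phi> (\<lambda>psi. q m psi u)" for m u
    define y where "y m u = q m phi u" for m u
    have dx: "d n W \<Phi> = (\<Sum>m<M. \<Sum>u<l. (x m u - y m u)\<^sup>2)" by (simp add: d_def x_def y_def)
    have "\<Delta> \<le> d n W \<Phi>" unfolding \<Delta>_def using mix by (intro cInf_lower bdd) (auto simp: X_def)
    \<comment> \<open>The coefficients \<open>x m u - y m u\<close> are half the gradient of the
      squared distance at the current mixture; \<open>phi\<close> itself then serves as the
      competitor.\<close>
    obtain psi where psi: "psi \<in> U" and psi_le: "\<And>phi. phi \<in> D \<Longrightarrow>
        (\<Sum>m<M. \<Sum>u<l. (x m u - y m u) * q m psi u) \<le> (\<Sum>m<M. \<Sum>u<l. (x m u - y m u) * q m phi u) + \<eta>"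
      using approximately_optimal_ULQ[OF \<eta>, of "\<lambda>u m. x m u - y m u"] by blast
    have psi_y: "(\<Sum>m<M. \<Sum>u<l. (x m u - y m u) * q m psi u) \<le> (\<Sum>m<M. \<Sum>u<l. (x m u - y m u) * y m u) + \<eta>"
      using psi_le[OF phi] by (simp add: y_def)
    define z where "z m u = q m psi u" for m u
    define W' where "W' i = (if i < n then (1 - \<gamma>) * W i else \<gamma>)" for i
    define \<Phi>' where "\<Phi>' = \<Phi>(n := psi)"
    have avg': "avg (Suc n) W' \<Phi>' h = (1 - \<gamma>) * avg n W \<Phi> h + \<gamma> * h psi" for h
      unfolding sum_distrib_left by (simp add: W'_def \<Phi>'_def mult_ac)
    have mix': "mixture U (Suc n) W' \<Phi>'"
      using mix psi \<gamma> avg'[of "\<lambda>_. 1"] by (auto simp: mixture_def W'_def \<Phi>'_def)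
    have xb: "0 \<le> x m u \<and> x m u \<le> 1" if "m < M" for m u
    proof
      show "0 \<le> x m u" using mix that by (auto simp: x_def mixture_def qpmf_bounds intro!: sum_nonneg)
      have "x m u \<le> (\<Sum>i<n. W i * 1)" unfolding x_def
        using mix that by (intro sum_mono mult_left_mono) (auto simp: mixture_def qpmf_bounds)
      then show "x m u \<le> 1" using mix by (simp add: mixture_def)
    qed
    have x': "avg (Suc n) W' \<Phi>' (\<lambda>psi. q m psi u) = (1 - \<gamma>) * x m u + \<gamma> * z m u" for m u
      unfolding x_def z_def by (rule avg')
    have "\<Delta> \<le> d (Suc n) W' \<Phi>'"
      unfolding \<Delta>_def using mix' by (intro cInf_lower bdd) (auto simp: X_def)
    also have "\<dots> = (\<Sum>m<M. \<Sum>u<l. (x m u - y m u)\<^sup>2 + (2 * \<gamma>) * ((x m u - y m u) * z m u)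
        - (2 * \<gamma>) * ((x m u - y m u) * x m u) + \<gamma>\<^sup>2 * (z m u - x m u)\<^sup>2)"
      unfolding d_def x' y_def[symmetric]
      by (intro sum.cong refl) (simp add: algebra_simps power2_eq_square)
    also have "\<dots> = d n W \<Phi> + 2 * \<gamma> * (\<Sum>m<M. \<Sum>u<l. (x m u - y m u) * z m u)
        - 2 * \<gamma> * (\<Sum>m<M. \<Sum>u<l. (x m u - y m u) * x m u) + \<gamma>\<^sup>2 * (\<Sum>m<M. \<Sum>u<l. (z m u - x m u)\<^sup>2)"
      unfolding dx sum.distrib sum_subtractf sum_distrib_left ..
    also have "(\<Sum>m<M. \<Sum>u<l. (z m u - x m u)\<^sup>2) \<le> (\<Sum>m<M. \<Sum>u<l. 1)"
    proof (intro sum_mono)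
      fix m u assume "m \<in> {..<M}"
      then have "\<bar>z m u - x m u\<bar> \<le> 1" using xb[of m u] qpmf_bounds[of m psi u] by (auto simp: z_def)
      then show "(z m u - x m u)\<^sup>2 \<le> 1" by (simp add: abs_square_le_1)
    qed
    also have "(\<Sum>m<M. \<Sum>u<l. 1 :: real) = K" by (simp add: K_def)
    also have "(\<Sum>m<M. \<Sum>u<l. (x m u - y m u) * z m u) \<le> (\<Sum>m<M. \<Sum>u<l. (x m u - y m u) * y m u) + \<eta>"
      using psi_y by (simp add: z_def)
    also have "(\<Sum>m<M. \<Sum>u<l. (x m u - y m u) * y m u)
        = (\<Sum>m<M. \<Sum>u<l. (x m u - y m u) * x m u) - d n W \<Phi>"
      unfolding dx sum_subtractf[symmetric]
      by (intro sum.cong refl) (simp add: algebra_simps power2_eq_square)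
    finally have "\<Delta> \<le> d n W \<Phi> - 2 * \<gamma> * (d n W \<Phi> - \<eta>) + \<gamma>\<^sup>2 * K"
      using \<gamma> by (simp add: algebra_simps)
    moreover have "\<gamma>\<^sup>2 * K \<le> \<gamma> * \<Delta>" using \<gamma> mult_left_mono[OF \<gamma>(3), of \<gamma>] by (simp add: power2_eq_square)
    moreover have "\<gamma> * \<Delta> \<le> \<gamma> * d n W \<Phi>" using \<gamma> \<open>\<Delta> \<le> d n W \<Phi>\<close> by simp
    moreover have "\<gamma> * \<eta> \<le> 1/2 * \<eta>" using \<gamma> \<eta> by (intro mult_right_mono) auto
    ultimately show False using dlt \<eta> unfolding \<eta>_def by (simp add: algebra_simps)
  qed
  then have "Inf X < e" using assms by (simp add: \<Delta>_def)
  then obtain y where "y \<in> X" "y < e" using cInf_lessD[OF ne] by blast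
  then show ?thesis using that by (auto simp: X_def d_def)
qed

text \<open>Let the averaged message probabilities of ULQ mixtures converge to those of
  \<open>phi\<close>. By continuity the divergence of the averages tends to the information number
  of \<open>phi\<close>, and by convexity the mixtures do at least as well as their averages. Only
  this one-sided bound is claimed.\<close>

lemma Idet_approximated_by_ULQ_mixture:
  assumes m: "m < M" and phi: "phi \<in> D" and e: "0 < e"
  obtains n W \<Phi> where "mixture U n W \<Phi>"
    "\<And>m'. m' < M \<Longrightarrow> m' \<noteq> m \<Longrightarrow> Id m m' phi - e \<le> avg n W \<Phi> (Id m m')"
proof -
  define Q where "Q s n W \<Phi> \<longleftrightarrow> mixture U n W \<Phi> \<and>
    (\<Sum>m<M. \<Sum>u<l. (avg n W \<Phi> (\<lambda>psi. q m psi u) - q m phi u)\<^sup>2) < 1 / real (Suc s)" for s n W \<Phi>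
  have "\<exists>n W \<Phi>. Q s n W \<Phi>" for s
    unfolding Q_def by (rule qpmf_approximated_by_ULQ_mixture[OF phi, of "1 / real (Suc s)"]) auto
  then obtain n W \<Phi> where "\<And>s. Q s (n s) (W s) (\<Phi> s)" by metis
  then have mix: "\<And>s. mixture U (n s) (W s) (\<Phi> s)" and
    d: "\<And>s. (\<Sum>m<M. \<Sum>u<l. (avg (n s) (W s) (\<Phi> s) (\<lambda>psi. q m psi u) - q m phi u)\<^sup>2) < 1 / real (Suc s)"
    by (auto simp: Q_def)
  have mixD: "mixture D (n s) (W s) (\<Phi> s)" for s using mixture_mono[OF mix U_subset_D] .
  have lim: "(\<lambda>s. avg (n s) (W s) (\<Phi> s) (\<lambda>psi. q k psi u)) \<longlonglongrightarrow> q k phi u" if "k < M" "u < l" for k u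
  proof -
    have "(avg (n s) (W s) (\<Phi> s) (\<lambda>psi. q k psi u) - q k phi u)\<^sup>2 \<le> 1 / real (Suc s)" for s
    proof -
      have "(avg (n s) (W s) (\<Phi> s) (\<lambda>psi. q k psi u) - q k phi u)\<^sup>2
        \<le> (\<Sum>u<l. (avg (n s) (W s) (\<Phi> s) (\<lambda>psi. q k psi u) - q k phi u)\<^sup>2)"
        using that by (intro member_le_sum) auto
      also have "\<dots> \<le> (\<Sum>m<M. \<Sum>u<l. (avg (n s) (W s) (\<Phi> s) (\<lambda>psi. q m psi u) - q m phi u)\<^sup>2)"
        using that by (intro member_le_sum[of k]) (auto intro: sum_nonneg)
      finally show ?thesis using d[of s] by simp
    qed
    then have "(\<lambda>s. (avg (n s) (W s) (\<Phi> s) (\<lambda>psi. q k psi u) - q k phi u)\<^sup>2) \<longlonglongrightarrow> 0"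
      by (intro tendsto_sandwich[OF _ _ tendsto_const LIMSEQ_Suc[OF lim_1_over_n]]) auto
    then have "(\<lambda>s. avg (n s) (W s) (\<Phi> s) (\<lambda>psi. q k psi u) - q k phi u) \<longlonglongrightarrow> 0"
      using tendsto_real_sqrt[of _ 0 sequentially] by (force simp: tendsto_rabs_zero_iff)
    then show ?thesis by (simp add: LIM_zero_iff)
  qed
  have "\<forall>\<^sub>F s in sequentially. Id m m' phi - e < avg (n s) (W s) (\<Phi> s) (Id m m')"
    if m': "m' \<in> {..<M} - {m}" for m'
  proof -
    have mm: "m' < M" "m \<noteq> m'" using m' by auto
    have "\<forall>\<^sub>F s in sequentially. Id m m' phi - e < (\<Sum>u<l. avg (n s) (W s) (\<Phi> s) (\<lambda>phi. q m phi u)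
            * ln (avg (n s) (W s) (\<Phi> s) (\<lambda>phi. q m phi u) / avg (n s) (W s) (\<Phi> s) (\<lambda>phi. q m' phi u)))"
      using Idet_mixture_tendsto[OF m mm mixD lim[OF m] lim[OF mm(1)]] e
      by (intro order_tendstoD(1)) (auto simp: Idet_def)
    then show ?thesis
      by (rule eventually_mono) (rule less_le_trans[OF _ Idet_mixture_ge[OF m mm(1) mixD]])
  qed
  then have "\<forall>\<^sub>F s in sequentially. \<forall>m'\<in>{..<M} - {m}. Id m m' phi - e < avg (n s) (W s) (\<Phi> s) (Id m m')"
    by (intro eventually_ball_finite) auto
  then obtain s where "\<forall>m'\<in>{..<M} - {m}. Id m m' phi - e < avg (n s) (W s) (\<Phi> s) (Id m m')"
    by (auto simp: eventually_sequentially)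
  then show ?thesis using mix[of s] by (intro that[of "n s" "W s" "\<Phi> s"]) (auto intro: less_imp_le)
qed

section \<open>Mixtures with M - 1 components\<close>

lemma other_states: "m < M \<Longrightarrow> card ({..<M} - {m}) = M - 1" "m < M \<Longrightarrow> {..<M} - {m} \<noteq> {}"
proof -
  show c: "card ({..<M} - {m}) = M - 1" if "m < M" using that by simp
  show "{..<M} - {m} \<noteq> {}" if "m < M" using c[OF that] M2 by (metis card.empty diff_is_0_eq not_less_eq_eq numeral_2_eq_2 One_nat_def)
qed

lemma mixture_reduce:
  assumes m: "m < M" and mix: "mixture S n W \<Phi>"
  obtains W' \<Phi>' where "mixture S (M - 1) W' \<Phi>'"
    "\<And>m'. m' < M \<Longrightarrow> m' \<noteq> m \<Longrightarrow> avg n W \<Phi> (Id m m') \<le> avg (M - 1) W' \<Phi>' (Id m m')"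
proof -
  let ?J = "{..<M} - {m}"
  have W: "\<And>a. a \<in> {..<n} \<Longrightarrow> 0 \<le> W a" "sum W {..<n} = 1" using mix by (auto simp: mixture_def)
  obtain w h where wh: "\<And>i. i < card ?J \<Longrightarrow> 0 \<le> w i" "\<And>i. i < card ?J \<Longrightarrow> h i \<in> {..<n}"
    "(\<Sum>i<card ?J. w i) = 1"
    "\<And>j. j \<in> ?J \<Longrightarrow> (\<Sum>a<n. W a * Id m j (\<Phi> a)) \<le> (\<Sum>i<card ?J. w i * Id m j (\<Phi> (h i)))"
    using mixture_reduction[where v="\<lambda>j a. Id m j (\<Phi> a)" and J="?J" and A="{..<n}" and w=W,
        OF _ _ other_states(2)[OF m] W] by auto
  show ?thesis
    using wh mix by (intro that[of w "\<lambda>i. \<Phi> (h i)"]) (auto simp: other_states(1)[OF m] mixture_def)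
qed

text \<open>Every component is replaced by a ULQ mixture, the two-level mixture is flattened with
  product weights, and its support is reduced last, so that the number of ULQs used per component
  does not matter.\<close>

lemma mixture_approximated_by_ULQ_mixture:
  assumes m: "m < M" and mix: "mixture D n W \<Phi>" and e: "0 < e"
  obtains W' \<Phi>' where "mixture U (M - 1) W' \<Phi>'"
    "\<And>m'. m' < M \<Longrightarrow> m' \<noteq> m \<Longrightarrow> avg n W \<Phi> (Id m m') - e \<le> avg (M - 1) W' \<Phi>' (Id m m')"
proof -
  let ?J = "{..<M} - {m}"
  define Q where "Q i k V \<Psi> \<longleftrightarrow> mixture U k V \<Psi> \<and>
    (\<forall>m'<M. m' \<noteq> m \<longrightarrow> Id m m' (\<Phi> i) - e \<le> avg k V \<Psi> (Id m m'))" for i k V \<Psi>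
  have "\<exists>k V \<Psi>. Q i k V \<Psi>" if "i < n" for i
  proof -
    have "\<Phi> i \<in> D" using that mix by (auto simp: mixture_def)
    then show ?thesis
      by (rule Idet_approximated_by_ULQ_mixture[OF m _ e]) (auto simp: Q_def)
  qed
  then obtain k V \<Psi> where "\<And>i. i < n \<Longrightarrow> Q i (k i) (V i) (\<Psi> i)" by metis
  then have *: "\<And>i. i < n \<Longrightarrow> mixture U (k i) (V i) (\<Psi> i)"
    "\<And>i m'. i < n \<Longrightarrow> m' < M \<Longrightarrow> m' \<noteq> m \<Longrightarrow> Id m m' (\<Phi> i) - e \<le> avg (k i) (V i) (\<Psi> i) (Id m m')"
    by (auto simp: Q_def)
  define A where "A = Sigma {..<n} (\<lambda>i. {..<k i})"
  define w where "w = (\<lambda>(i, j). W i * V i j)"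
  have sumA: "(\<Sum>a\<in>A. w a * g (\<Psi> (fst a) (snd a))) = (\<Sum>i<n. W i * avg (k i) (V i) (\<Psi> i) g)" for g
    unfolding A_def w_def sum_distrib_left
    by (subst sum.Sigma) (auto simp: case_prod_beta mult_ac)
  have w: "\<And>a. a \<in> A \<Longrightarrow> 0 \<le> w a" "finite A"
    using mix *(1) by (auto simp: A_def w_def mixture_def)
  have w1: "sum w A = 1"
    using sumA[of "\<lambda>_. 1"] *(1) mix by (simp add: mixture_def)
  obtain w' h where wh: "\<And>i. i < card ?J \<Longrightarrow> 0 \<le> w' i" "\<And>i. i < card ?J \<Longrightarrow> h i \<in> A"
    "(\<Sum>i<card ?J. w' i) = 1"
    "\<And>j. j \<in> ?J \<Longrightarrow> (\<Sum>a\<in>A. w a * Id m j (\<Psi> (fst a) (snd a)))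
        \<le> (\<Sum>i<card ?J. w' i * Id m j (\<Psi> (fst (h i)) (snd (h i))))"
    using mixture_reduction[where v="\<lambda>j a. Id m j (\<Psi> (fst a) (snd a))" and J="?J" and A=A and w=w,
        OF w(2) _ other_states(2)[OF m] w(1) w1] by auto
  show ?thesis
  proof (rule that[of w' "\<lambda>i. \<Psi> (fst (h i)) (snd (h i))"])
    have "\<Psi> (fst a) (snd a) \<in> U" if "a \<in> A" for a using *(1) that by (auto simp: A_def mixture_def)
    then show "mixture U (M - 1) w' (\<lambda>i. \<Psi> (fst (h i)) (snd (h i)))"
      using wh unfolding other_states(1)[OF m] mixture_def by blast
    fix m' assume m': "m' < M" "m' \<noteq> m"
    have "avg n W \<Phi> (Id m m') - e = (\<Sum>i<n. W i * (Id m m' (\<Phi> i) - e))"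
      using mix by (simp add: mixture_def algebra_simps sum_subtractf flip: sum_distrib_left)
    also have "\<dots> \<le> (\<Sum>i<n. W i * avg (k i) (V i) (\<Psi> i) (Id m m'))"
      using *(2) m' mix by (intro sum_mono mult_left_mono) (auto simp: mixture_def)
    also have "\<dots> \<le> avg (M - 1) w' (\<lambda>i. \<Psi> (fst (h i)) (snd (h i))) (Id m m')"
      using wh(4)[of m'] m' sumA[of "Id m m'"] by (simp add: other_states(1)[OF m])
    finally show "avg n W \<Phi> (Id m m') - e \<le> avg (M - 1) w' (\<lambda>i. \<Psi> (fst (h i)) (snd (h i))) (Id m m')" .
  qed
qed

subsection \<open>Existence of a maximin quantizer\<close>

text \<open>By Borel-Cantelli, almost every observation sees a sequence of messages that is
  eventually constant. Since null sets are shared, this holds under every \<open>P k\<close>, and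
  dominated convergence identifies the message probabilities of the limit.\<close>

lemma ae_limit_quantizer:
  assumes m: "m < M" and D: "\<And>n. \<phi> n \<in> D"
    and summ: "\<And>n. measure (P m) {x\<in>space mu. \<phi> n x \<noteq> \<phi> (Suc n) x} \<le> (1/2) ^ n"
    and lim: "\<And>k u. k < M \<Longrightarrow> u < l \<Longrightarrow> (\<lambda>n. q k (\<phi> n) u) \<longlonglongrightarrow> y k u"
  obtains phi where "phi \<in> D" "\<And>k u. k < M \<Longrightarrow> u < l \<Longrightarrow> q k phi u = y k u"
proof -
  have [measurable]: "\<phi> n \<in> measurable mu (count_space UNIV)" for n
    using D[of n] by (simp add: det_quantizer_def)
  \<comment> \<open>\<open>LEAST\<close> picks the value at which the sequence settles, in a
    measurable way. Where it does not settle the value is arbitrary, and the minimum with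
    \<open>l - 1\<close> keeps it a message.\<close>
  define phi where "phi x = min (l - 1) (LEAST u. \<exists>N. \<forall>n\<ge>N. \<phi> n x = u)" for x
  have "phi \<in> measurable mu (count_space UNIV)" unfolding phi_def by measurable
  moreover have "phi x < l" for x using l2 by (auto simp: phi_def min_def)
  ultimately have phi: "phi \<in> D" by (simp add: det_quantizer_def)
  have neq: "{x\<in>space mu. \<phi> n x \<noteq> \<phi> (Suc n) x} \<in> sets mu" for n
  proof -
    have "{x\<in>space mu. \<phi> n x \<noteq> \<phi> (Suc n) x} = {x\<in>space mu. \<exists>u. \<phi> n x = u \<and> \<phi> (Suc n) x \<noteq> u}" by auto
    also have "\<dots> \<in> sets mu" by measurable
    finally show ?thesis .
  qed
  interpret prob_space "P m" by (rule prob_space_P[OF m])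
  have "AE x in P m. \<forall>\<^sub>F n in sequentially. x \<in> space (P m) - {x\<in>space mu. \<phi> n x \<noteq> \<phi> (Suc n) x}"
  proof (rule borel_cantelli_AE1)
    show "summable (\<lambda>n. measure (P m) {x\<in>space mu. \<phi> n x \<noteq> \<phi> (Suc n) x})"
      by (rule summable_comparison_test'[of "\<lambda>n. (1/2)^n" 0]) (use summ in auto)
  qed (use neq in \<open>auto simp: emeasure_eq_measure\<close>)
  then have AE: "AE x in P m. \<forall>\<^sub>F n in sequentially. \<phi> n x = phi x"
  proof (rule AE_mp, intro AE_I2 impI)
    fix x assume x: "x \<in> space (P m)"
      and "\<forall>\<^sub>F n in sequentially. x \<in> space (P m) - {x\<in>space mu. \<phi> n x \<noteq> \<phi> (Suc n) x}"
    then obtain N where N: "\<And>n. n \<ge> N \<Longrightarrow> \<phi> n x = \<phi> (Suc n) x"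
      by (auto simp: eventually_sequentially)
    have const: "\<phi> n x = \<phi> N x" if "n \<ge> N" for n
      using that by (induction rule: dec_induct) (simp_all add: N[symmetric])
    have "(LEAST u. \<exists>N. \<forall>n\<ge>N. \<phi> n x = u) = \<phi> N x"
    proof (rule Least_equality)
      fix u assume "\<exists>N. \<forall>n\<ge>N. \<phi> n x = u"
      then obtain N' where "\<forall>n\<ge>N'. \<phi> n x = u" by blast
      then have "u = \<phi> (max N N') x" by simp
      then show "\<phi> N x \<le> u" using const[of "max N N'"] by simp
    qed (use const in blast)
    moreover have "\<phi> N x < l" using D[of N] x by (simp add: det_quantizer_def)
    ultimately have phi_x: "phi x = \<phi> N x" by (simp add: phi_def)
    show "\<forall>\<^sub>F n in sequentially. \<phi> n x = phi x"
      unfolding phi_x by (rule eventually_sequentiallyI[of N]) (rule const)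
  qed
  have "q k phi u = y k u" if k: "k < M" "u < l" for k u
  proof -
    interpret k: prob_space "P k" by (rule prob_space_P[OF k(1)])
    have AEk: "AE x in P k. \<forall>\<^sub>F n in sequentially. \<phi> n x = phi x"
      by (rule AE_P_transfer[OF m k(1) AE])
    have [measurable]: "phi -` {u} \<inter> space mu \<in> sets mu" "\<phi> n -` {u} \<inter> space mu \<in> sets mu" for n
      by (rule D_vimage[OF phi], rule D_vimage[OF D])
    have "(\<lambda>n. \<integral>x. indicator (\<phi> n -` {u} \<inter> space mu) x \<partial>P k)
        \<longlonglongrightarrow> (\<integral>x. (indicator (phi -` {u} \<inter> space mu) x :: real) \<partial>P k)"
    proof (rule integral_dominated_convergence[where w="\<lambda>_. 1"])
      show "AE x in P k. (\<lambda>n. indicator (\<phi> n -` {u} \<inter> space mu) x)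
          \<longlonglongrightarrow> (indicator (phi -` {u} \<inter> space mu) x :: real)"
        using AEk
      proof (rule AE_mp, intro AE_I2 impI)
        fix x assume "\<forall>\<^sub>F n in sequentially. \<phi> n x = phi x"
        then have "\<forall>\<^sub>F n in sequentially. indicator (\<phi> n -` {u} \<inter> space mu) x
            = (indicator (phi -` {u} \<inter> space mu) x :: real)"
          by eventually_elim (auto simp: indicator_def)
        then show "(\<lambda>n. indicator (\<phi> n -` {u} \<inter> space mu) x)
          \<longlonglongrightarrow> (indicator (phi -` {u} \<inter> space mu) x :: real)" by (rule tendsto_eventually)
      qed
    qed (auto simp: indicator_abs_le_1)
    then have "(\<lambda>n. q k (\<phi> n) u) \<longlonglongrightarrow> q k phi u"
      using qpmf_eq_integral[OF phi] qpmf_eq_integral[OF D] by simp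
    from LIMSEQ_unique[OF this lim[OF k]] show ?thesis .
  qed
  with phi that show ?thesis by blast
qed

text \<open>Hypothesis \<open>cauchy\<close> is the Cauchy property in probability, phrased with
  arbitrary late indices as the exchange argument delivers it. A subsequence with summable
  disagreement probabilities has an almost sure limit.\<close>

lemma Cauchy_limit_quantizer:
  assumes m: "m < M" and D: "\<And>n. \<phi> n \<in> D"
    and cauchy: "\<And>r s u. (\<And>n. n \<le> r n) \<Longrightarrow> (\<And>n. n \<le> s n) \<Longrightarrow> u < l \<Longrightarrow>
      (\<lambda>n. measure (P m) {x\<in>space mu. \<phi> (r n) x = u \<and> \<phi> (s n) x \<noteq> u}) \<longlonglongrightarrow> 0"
    and lim: "\<And>k u. k < M \<Longrightarrow> u < l \<Longrightarrow> (\<lambda>n. q k (\<phi> n) u) \<longlonglongrightarrow> y k u"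
  obtains phi where "phi \<in> D" "\<And>k u. k < M \<Longrightarrow> u < l \<Longrightarrow> q k phi u = y k u"
proof -
  interpret prob_space "P m" by (rule prob_space_P[OF m])
  have [measurable]: "\<phi> n \<in> measurable mu (count_space UNIV)" for n
    using D[of n] by (simp add: det_quantizer_def)
  define d where "d n k = prob {x\<in>space mu. \<phi> n x \<noteq> \<phi> k x}" for n k
  have d_le: "d n k \<le> (\<Sum>u<l. prob {x\<in>space mu. \<phi> n x = u \<and> \<phi> k x \<noteq> u})" for n k
  proof -
    have "{x\<in>space mu. \<phi> n x \<noteq> \<phi> k x} = (\<Union>u<l. {x\<in>space mu. \<phi> n x = u \<and> \<phi> k x \<noteq> u})"
      using D[of n] by (auto simp: det_quantizer_def)
    then show ?thesis unfolding d_def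
      by (simp only:) (rule finite_measure_subadditive_finite, auto)
  qed
  have ex: "\<exists>N. \<forall>n\<ge>N. \<forall>k\<ge>N. d n k < e" if e: "e > 0" for e
  proof (rule ccontr)
    assume "\<not> ?thesis"
    \<comment> \<open>Failure at scale \<open>e\<close> supplies late pairs of indices whose
      disagreement probability never drops below \<open>e\<close>.\<close>
    then obtain r s where rs: "\<And>N. N \<le> r N" "\<And>N. N \<le> s N" "\<And>N. e \<le> d (r N) (s N)"
      by (metis not_less)
    have "(\<lambda>n. \<Sum>u<l. prob {x\<in>space mu. \<phi> (r n) x = u \<and> \<phi> (s n) x \<noteq> u}) \<longlonglongrightarrow> (\<Sum>u<l. 0)"
      by (intro tendsto_sum cauchy rs) auto
    then have "(\<lambda>n. \<Sum>u<l. prob {x\<in>space mu. \<phi> (r n) x = u \<and> \<phi> (s n) x \<noteq> u}) \<longlonglongrightarrow> 0" by simp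
    from LIMSEQ_le_const[OF this, of e] have "e \<le> 0"
      using order_trans[OF rs(3) d_le] by blast
    with e show False by simp
  qed
  have "\<forall>j. \<exists>N. \<forall>n\<ge>N. \<forall>k\<ge>N. d n k < (1/2) ^ j" using ex by simp
  then obtain N where N: "\<And>j n k. n \<ge> N j \<Longrightarrow> k \<ge> N j \<Longrightarrow> d n k < (1/2) ^ j" by metis
  \<comment> \<open>The partial sums dominate each \<open>N j\<close>, and the summand
    \<open>j\<close> makes \<open>t\<close> strictly increasing.\<close>
  define t where "t j = j + (\<Sum>i\<le>j. N i)" for j
  have "N j \<le> (\<Sum>i\<le>j. N i)" for j by (intro member_le_sum) auto
  then have tN: "N j \<le> t j" "N j \<le> t (Suc j)" for j
    by (auto simp: t_def intro: trans_le_add2 le_SucI trans_le_add1)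
  have "strict_mono t" by (auto simp: strict_mono_Suc_iff t_def)
  have "prob {x\<in>space mu. \<phi> (t j) x \<noteq> \<phi> (t (Suc j)) x} \<le> (1/2) ^ j" for j
    using N[OF tN] by (simp add: d_def less_imp_le)
  moreover have "(\<lambda>n. q k (\<phi> (t n)) u) \<longlonglongrightarrow> y k u" if "k < M" "u < l" for k u
    using LIMSEQ_subseq_LIMSEQ[OF lim[OF that] \<open>strict_mono t\<close>] by (simp add: o_def)
  ultimately show ?thesis
    using ae_limit_quantizer[OF m, of "\<lambda>n. \<phi> (t n)" y] D that by blast
qed

text \<open>The secondary objective, strictly convex in the message distribution under
  \<open>P m\<close>; its mean over a mixture rewards components that differ.\<close>

abbreviation sqn :: "nat \<Rightarrow> ('a \<Rightarrow> nat) \<Rightarrow> real" where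
  "sqn m phi \<equiv> (\<Sum>u<l. (q m phi u)\<^sup>2)"

text \<open>Here \<open>s\<close> is the limit, as \<open>d\<close> tends to 0, of the largest
  secondary mean among mixtures within \<open>d\<close> of maximin. The last clause admits mixtures
  of any length because the exchange argument adds a component to the \<open>M\<close>
  present.\<close>

lemma lexicographically_maximizing_mixtures:
  assumes m: "m < M"
  obtains W \<Phi> s where "\<And>n::nat. mixture D M (W n) (\<Phi> n)"
    "\<And>n m'. m' < M \<Longrightarrow> m' \<noteq> m \<Longrightarrow> Imax mu f M l m - 1 / real (Suc n) \<le> avg M (W n) (\<Phi> n) (Id m m')"
    "\<And>n. s - 1 / real (Suc n) \<le> avg M (W n) (\<Phi> n) (sqn m)"
    "\<And>e. 0 < e \<Longrightarrow> \<exists>d>0. \<forall>k V \<Psi>. mixture D k V \<Psi> \<longrightarrow>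
      (\<forall>m'<M. m' \<noteq> m \<longrightarrow> Imax mu f M l m - d \<le> avg k V \<Psi> (Id m m')) \<longrightarrow> avg k V \<Psi> (sqn m) \<le> s + e"
proof -
  let ?V = "Imax mu f M l m"
  define near where "near d k V \<Psi> \<longleftrightarrow> mixture D k V \<Psi> \<and> (\<forall>m'<M. m' \<noteq> m \<longrightarrow> ?V - d \<le> avg k V \<Psi> (Id m m'))" for d k V \<Psi>
  define F where "F d = {avg k V \<Psi> (sqn m) | k V \<Psi>. near d k V \<Psi>}" for d
  have ne: "F d \<noteq> {}" if "0 < d" for d
    by (rule approximately_maximin_mixture[OF m that]) (auto simp: F_def near_def)
  have avg_bound: "0 \<le> avg k V \<Psi> (sqn m)" "avg k V \<Psi> (sqn m) \<le> real l" if "mixture D k V \<Psi>" for k V \<Psi>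
  proof -
    show "0 \<le> avg k V \<Psi> (sqn m)" using that by (auto simp: mixture_def intro!: sum_nonneg mult_nonneg_nonneg)
    have "sqn m phi \<le> (\<Sum>u<l. 1)" for phi
      using m by (intro sum_mono) (auto simp: qpmf_bounds power_le_one)
    then have "avg k V \<Psi> (sqn m) \<le> avg k V \<Psi> (\<lambda>_. real l)"
      using that by (intro sum_mono mult_left_mono) (auto simp: mixture_def)
    also have "\<dots> = real l" using that by (simp add: mixture_def flip: sum_distrib_right)
    finally show "avg k V \<Psi> (sqn m) \<le> real l" .
  qed
  have bdd: "bdd_above (F d)" for d
    by (rule bdd_aboveI[of _ "real l"]) (auto simp: F_def near_def avg_bound)
  \<comment> \<open>\<open>Sup (F d)\<close> is monotone in \<open>d\<close>, so the infimum is its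
    limit at 0.\<close>
  define s where "s = Inf ((\<lambda>d. Sup (F d)) ` {0<..})"
  have bb: "bdd_below ((\<lambda>d. Sup (F d)) ` {0<..})"
  proof (rule bdd_belowI2[of _ 0])
    fix d :: real assume "d \<in> {0<..}"
    then obtain z where z: "z \<in> F d" using ne[of d] by auto
    then have "0 \<le> z" by (auto simp: F_def near_def avg_bound)
    also have "z \<le> Sup (F d)" by (rule cSup_upper[OF z bdd])
    finally show "0 \<le> Sup (F d)" .
  qed
  define Q where "Q n W \<Phi> \<longleftrightarrow> near (1 / real (Suc n)) M W \<Phi> \<and> s - 1 / real (Suc n) \<le> avg M W \<Phi> (sqn m)"
    for n :: nat and W \<Phi>
  have "\<exists>W \<Phi>. Q n W \<Phi>" for n
  proof -
    let ?e = "1 / real (Suc n)"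
    have e: "0 < ?e" by simp
    have "s \<le> Sup (F ?e)" unfolding s_def using e by (intro cInf_lower bb) auto
    then have "s - ?e < Sup (F ?e)" using e by linarith
    then obtain z where "z \<in> F ?e" "s - ?e < z" using less_cSup_iff[OF ne[OF e] bdd] by blast
    then obtain k V \<Psi> where kV: "near ?e k V \<Psi>" "s - ?e < avg k V \<Psi> (sqn m)" by (auto simp: F_def)
    \<comment> \<open>The secondary objective takes the vacant coordinate \<open>m\<close>; the
      \<open>M\<close> functionals together allow a reduction to \<open>M\<close>
      components.\<close>
    define v where "v j = (if j = m then sqn m else Id m j)" for j
    have V: "\<And>a. a \<in> {..<k} \<Longrightarrow> 0 \<le> V a" "sum V {..<k} = 1" using kV by (auto simp: near_def mixture_def)
    have J: "{..<M} \<noteq> {}" using m by auto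
    obtain w h where wh: "\<And>i. i < M \<Longrightarrow> 0 \<le> w i" "\<And>i. i < M \<Longrightarrow> h i \<in> {..<k}"
      "(\<Sum>i<M. w i) = 1"
      "\<And>j. j \<in> {..<M} \<Longrightarrow> (\<Sum>a<k. V a * v j (\<Psi> a)) \<le> (\<Sum>i<M. w i * v j (\<Psi> (h i)))"
      using mixture_reduction[where v="\<lambda>j a. v j (\<Psi> a)" and J="{..<M}" and A="{..<k}" and w=V,
          OF _ _ J V] by auto
    have mix: "mixture D M w (\<lambda>i. \<Psi> (h i))"
      using wh kV by (auto simp: mixture_def near_def)
    have "?V - ?e \<le> avg M w (\<lambda>i. \<Psi> (h i)) (Id m m')" if "m' < M" "m' \<noteq> m" for m'
    proof -
      have "?V - ?e \<le> avg k V \<Psi> (Id m m')" using kV(1) that unfolding near_def by blast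
      then show ?thesis using wh(4)[of m'] that by (simp add: v_def)
    qed
    moreover have "s - ?e \<le> avg M w (\<lambda>i. \<Psi> (h i)) (sqn m)"
      using wh(4)[of m] kV(2) m by (simp add: v_def)
    ultimately show ?thesis using mix unfolding Q_def near_def by blast
  qed
  then obtain W \<Phi> where W\<Phi>: "\<And>n. Q n (W n) (\<Phi> n)" by metis
  show ?thesis
  proof (rule that[of W \<Phi> s])
    fix e :: real assume "0 < e"
    then have "s < s + e" by simp
    then obtain d where d: "0 < d" "Sup (F d) < s + e"
      using cInf_lessD[of "(\<lambda>d. Sup (F d)) ` {0<..}" "s + e"] by (auto simp: s_def)
    have "avg k V \<Psi> (sqn m) \<le> s + e" if "near d k V \<Psi>" for k V \<Psi>
      using cSup_upper[OF _ bdd, of "avg k V \<Psi> (sqn m)" d] d that by (fastforce simp: F_def)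
    with d show "\<exists>d>0. \<forall>k V \<Psi>. mixture D k V \<Psi> \<longrightarrow>
      (\<forall>m'<M. m' \<noteq> m \<longrightarrow> ?V - d \<le> avg k V \<Psi> (Id m m')) \<longrightarrow> avg k V \<Psi> (sqn m) \<le> s + e"
      unfolding near_def by blast
  qed (use W\<Phi> in \<open>auto simp: Q_def near_def\<close>)
qed

text \<open>The values of \<phi> and \<psi> are exchanged on the event that \<phi> sends
  \<open>u0\<close> and \<psi> does not. Exchanging preserves sums of message probabilities under
  every state, while the event now counts for \<beta> and not for \<alpha> at \<open>u0\<close>,
  which shifts the difference by twice its probability.\<close>

lemma swap_quantizers:
  assumes m: "m < M" and D: "\<phi> \<in> D" "\<psi> \<in> D" and u0: "u0 < l"
  obtains \<alpha> \<beta> where "\<alpha> \<in> D" "\<beta> \<in> D"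
    "\<And>k u. k < M \<Longrightarrow> q k \<alpha> u + q k \<beta> u = q k \<phi> u + q k \<psi> u"
    "q m \<beta> u0 - q m \<alpha> u0 = q m \<psi> u0 - q m \<phi> u0
       + 2 * measure (P m) {x\<in>space mu. \<phi> x = u0 \<and> \<psi> x \<noteq> u0}"
proof -
  have [measurable]: "\<phi> \<in> measurable mu (count_space UNIV)" "\<psi> \<in> measurable mu (count_space UNIV)"
    using D by (auto simp: det_quantizer_def)
  define B where "B x \<longleftrightarrow> \<phi> x = u0 \<and> \<psi> x \<noteq> u0" for x
  have [measurable]: "Measurable.pred mu B" unfolding B_def by measurable
  define \<alpha> where "\<alpha> x = (if B x then \<psi> x else \<phi> x)" for x
  define \<beta> where "\<beta> x = (if B x then \<phi> x else \<psi> x)" for x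
  have ab: "\<alpha> \<in> D" "\<beta> \<in> D"
    using D unfolding \<alpha>_def \<beta>_def by (auto simp: det_quantizer_def)
  define I where "I k Q = measure (P k) {x\<in>space mu. Q x}" for k Q
  have qI: "q k \<theta> u = I k (\<lambda>x. \<theta> x = u)" for k \<theta> u
    unfolding qpmf_def I_def by (intro arg_cong[where f="measure _"]) auto
  have split: "I k Q = I k (\<lambda>x. Q x \<and> B x) + I k (\<lambda>x. Q x \<and> \<not> B x)"
    if "k < M" and [measurable]: "Measurable.pred mu Q" for k Q
  proof -
    interpret prob_space "P k" by (rule prob_space_P[OF that(1)])
    have "{x\<in>space mu. Q x} = {x\<in>space mu. Q x \<and> B x} \<union> {x\<in>space mu. Q x \<and> \<not> B x}" by auto
    then show ?thesis unfolding I_def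
      by (simp only:) (rule finite_measure_Union, auto)
  qed
  have s\<alpha>: "q k \<alpha> u = I k (\<lambda>x. \<psi> x = u \<and> B x) + I k (\<lambda>x. \<phi> x = u \<and> \<not> B x)" if "k < M" for k u
  proof -
    have "q k \<alpha> u = I k (\<lambda>x. \<alpha> x = u \<and> B x) + I k (\<lambda>x. \<alpha> x = u \<and> \<not> B x)"
      unfolding qI using that by (intro split) (auto simp: \<alpha>_def[abs_def])
    also have "(\<lambda>x. \<alpha> x = u \<and> B x) = (\<lambda>x. \<psi> x = u \<and> B x)" by (auto simp: \<alpha>_def)
    also have "(\<lambda>x. \<alpha> x = u \<and> \<not> B x) = (\<lambda>x. \<phi> x = u \<and> \<not> B x)" by (auto simp: \<alpha>_def)
    finally show ?thesis .
  qed
  have s\<beta>: "q k \<beta> u = I k (\<lambda>x. \<phi> x = u \<and> B x) + I k (\<lambda>x. \<psi> x = u \<and> \<not> B x)" if "k < M" for k u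
  proof -
    have "q k \<beta> u = I k (\<lambda>x. \<beta> x = u \<and> B x) + I k (\<lambda>x. \<beta> x = u \<and> \<not> B x)"
      unfolding qI using that by (intro split) (auto simp: \<beta>_def[abs_def])
    also have "(\<lambda>x. \<beta> x = u \<and> B x) = (\<lambda>x. \<phi> x = u \<and> B x)" by (auto simp: \<beta>_def)
    also have "(\<lambda>x. \<beta> x = u \<and> \<not> B x) = (\<lambda>x. \<psi> x = u \<and> \<not> B x)" by (auto simp: \<beta>_def)
    finally show ?thesis .
  qed
  have s\<phi>: "q k \<phi> u = I k (\<lambda>x. \<phi> x = u \<and> B x) + I k (\<lambda>x. \<phi> x = u \<and> \<not> B x)"
    and s\<psi>: "q k \<psi> u = I k (\<lambda>x. \<psi> x = u \<and> B x) + I k (\<lambda>x. \<psi> x = u \<and> \<not> B x)" if "k < M" for k u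
    unfolding qI using that by (intro split; auto)+
  have B1: "(\<lambda>x. \<phi> x = u0 \<and> B x) = B" and B2: "(\<lambda>x. \<psi> x = u0 \<and> B x) = (\<lambda>_. False)"
    by (auto simp: B_def)
  have "I m (\<lambda>_. False) = 0" by (simp add: I_def)
  then have "q m \<beta> u0 - q m \<alpha> u0 = q m \<psi> u0 - q m \<phi> u0 + 2 * I m B"
    unfolding s\<alpha>[OF m] s\<beta>[OF m] s\<phi>[OF m] s\<psi>[OF m] B1 B2 by simp
  then show ?thesis
    using ab s\<alpha> s\<beta> s\<phi> s\<psi> by (intro that[of \<alpha> \<beta>]) (auto simp: I_def B_def)
qed

text \<open>Replacing the i-th component by a fair mixture of the two quantizers obtained by swapping
  two late terms of its sequence does not lower the information numbers in the limit, by convexity.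
  As the second-order objective is strictly convex and asymptotically maximal, the swap must become
  negligible.\<close>
lemma maximizing_components_Cauchy:
  assumes m: "m < M" and i: "i < M" and w: "0 < w"
    and mix: "\<And>n::nat. mixture D M (W n) (\<Phi> n)"
    and opt: "\<And>n m'. m' < M \<Longrightarrow> m' \<noteq> m \<Longrightarrow> V - \<delta> n \<le> avg M (W n) (\<Phi> n) (Id m m')"
    and opt2: "\<And>n. s - \<delta> n \<le> avg M (W n) (\<Phi> n) (sqn m)"
    and \<delta>: "\<delta> \<longlonglongrightarrow> 0"
    and max2: "\<And>e. 0 < e \<Longrightarrow> \<exists>d>0. \<forall>k X \<Psi>. mixture D k X \<Psi> \<longrightarrow>
      (\<forall>m'<M. m' \<noteq> m \<longrightarrow> V - d \<le> avg k X \<Psi> (Id m m')) \<longrightarrow> avg k X \<Psi> (sqn m) \<le> s + e"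
    and Wlim: "(\<lambda>n. W n i) \<longlonglongrightarrow> w"
    and lim: "\<And>k u. k < M \<Longrightarrow> u < l \<Longrightarrow> (\<lambda>n. q k (\<Phi> n i) u) \<longlonglongrightarrow> y k u"
    and r: "\<And>n. n \<le> r n" and t: "\<And>n. n \<le> t n" and u0: "u0 < l"
  shows "(\<lambda>n. measure (P m) {x\<in>space mu. \<Phi> (r n) i x = u0 \<and> \<Phi> (t n) i x \<noteq> u0}) \<longlonglongrightarrow> 0"
proof -
  define \<phi> where "\<phi> n = \<Phi> (r n) i" for n
  define \<psi> where "\<psi> n = \<Phi> (t n) i" for n
  define b where "b n = measure (P m) {x\<in>space mu. \<phi> n x = u0 \<and> \<psi> n x \<noteq> u0}" for n
  have D: "\<phi> n \<in> D" "\<psi> n \<in> D" for n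
    using mix i by (auto simp: \<phi>_def \<psi>_def mixture_def)
  define Q where "Q n \<alpha> \<beta> \<longleftrightarrow> \<alpha> \<in> D \<and> \<beta> \<in> D \<and> (\<forall>k u. k < M \<longrightarrow> q k \<alpha> u + q k \<beta> u = q k (\<phi> n) u + q k (\<psi> n) u) \<and>
    q m \<beta> u0 - q m \<alpha> u0 = q m (\<psi> n) u0 - q m (\<phi> n) u0 + 2 * b n" for n \<alpha> \<beta>
  have "\<exists>\<alpha> \<beta>. Q n \<alpha> \<beta>" for n
    by (rule swap_quantizers[OF m D(1)[of n] D(2)[of n] u0]) (auto simp: Q_def b_def)
  then obtain \<alpha> \<beta> where "\<And>n. Q n (\<alpha> n) (\<beta> n)" by metis
  then have ab: "\<And>n. \<alpha> n \<in> D" "\<And>n. \<beta> n \<in> D"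
    "\<And>n k u. k < M \<Longrightarrow> q k (\<alpha> n) u + q k (\<beta> n) u = q k (\<phi> n) u + q k (\<psi> n) u"
    "\<And>n. q m (\<beta> n) u0 - q m (\<alpha> n) u0 = q m (\<psi> n) u0 - q m (\<phi> n) u0 + 2 * b n"
    by (auto simp: Q_def)
  \<comment> \<open>The selected indices need not be monotone; tending to infinity is enough to
    inherit all limits.\<close>
  have rt: "filterlim r at_top sequentially" "filterlim t at_top sequentially"
    using r t by (auto intro!: filterlim_at_top_mono[OF filterlim_ident] always_eventually)
  have lim\<phi>: "(\<lambda>n. q k (\<phi> n) u) \<longlonglongrightarrow> y k u" and lim\<psi>: "(\<lambda>n. q k (\<psi> n) u) \<longlonglongrightarrow> y k u"
    if "k < M" "u < l" for k u
    unfolding \<phi>_def \<psi>_def using filterlim_compose[OF lim[OF that]] rt by auto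
  define c where "c n = W (r n) i" for n
  have c: "c \<longlonglongrightarrow> w" unfolding c_def by (rule filterlim_compose[OF Wlim rt(1)])
  have c01: "0 \<le> c n" "c n \<le> 1" for n
  proof -
    show "0 \<le> c n" using mix i by (auto simp: c_def mixture_def)
    have "W (r n) i \<le> (\<Sum>j<M. W (r n) j)" using mix i by (intro member_le_sum) (auto simp: mixture_def)
    then show "c n \<le> 1" using mix by (simp add: c_def mixture_def)
  qed
  \<comment> \<open>The weight of component \<open>i\<close> is halved between \<alpha>, which takes
    its slot, and \<beta>, which takes the new slot \<open>M\<close>.\<close>
  define W' where "W' n = (W (r n))(i := c n / 2, M := c n / 2)" for n
  define \<Phi>' where "\<Phi>' n = (\<Phi> (r n))(i := \<alpha> n, M := \<beta> n)" for n
  have avg': "avg (Suc M) (W' n) (\<Phi>' n) g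
      = avg M (W (r n)) (\<Phi> (r n)) g + c n * ((g (\<alpha> n) + g (\<beta> n)) / 2 - g (\<phi> n))" for n g
  proof -
    have "avg (Suc M) (W' n) (\<Phi>' n) g = avg M (W' n) (\<Phi>' n) g + c n / 2 * g (\<beta> n)"
      by (simp add: W'_def \<Phi>'_def)
    also have "avg M (W' n) (\<Phi>' n) g
        = c n / 2 * g (\<alpha> n) + (\<Sum>j\<in>{..<M} - {i}. W' n j * g (\<Phi>' n j))"
      using i by (subst sum.remove[of _ i]) (auto simp: W'_def \<Phi>'_def)
    also have "(\<Sum>j\<in>{..<M} - {i}. W' n j * g (\<Phi>' n j)) = (\<Sum>j\<in>{..<M} - {i}. W (r n) j * g (\<Phi> (r n) j))"
      by (intro sum.cong) (auto simp: W'_def \<Phi>'_def)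
    also have "\<dots> = avg M (W (r n)) (\<Phi> (r n)) g - c n * g (\<phi> n)"
      using i by (subst sum.remove[of _ i]) (auto simp: c_def \<phi>_def)
    finally show ?thesis by (simp add: algebra_simps add_divide_distrib)
  qed
  have mix': "mixture D (Suc M) (W' n) (\<Phi>' n)" for n
    using avg'[of n "\<lambda>_. 1"] mix[of "r n"] ab(1,2) c01 by (auto simp: mixture_def W'_def \<Phi>'_def less_Suc_eq)
  \<comment> \<open>This is also the midpoint for \<alpha> and \<beta>, as the swap preserves sums.
    Hence their average has the limit \<open>y\<close>, although neither sequence is known to
    converge.\<close>
  define mid where "mid n k u = (q k (\<phi> n) u + q k (\<psi> n) u) / 2" for n k u
  have lim_mid: "(\<lambda>n. mid n k u) \<longlonglongrightarrow> y k u" if "k < M" "u < l" for k u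
    using tendsto_divide[OF tendsto_add[OF lim\<phi>[OF that] lim\<psi>[OF that]] tendsto_const[of 2]]
    by (simp add: mid_def)
  define pair where "pair n j = (if j = 0 then \<alpha> n else \<beta> n)" for n and j :: nat
  have avg2: "avg 2 (\<lambda>_. 1/2) (pair n) g = (g (\<alpha> n) + g (\<beta> n)) / 2" for n g
    by (simp add: pair_def numeral_2_eq_2 add_divide_distrib)
  have mixpair: "mixture D 2 (\<lambda>_. 1/2) (pair n)" for n
    using ab(1,2) by (auto simp: mixture_def pair_def)
  have avgq: "avg 2 (\<lambda>_. 1/2) (pair n) (\<lambda>phi. q k phi u) = mid n k u" if "k < M" for n k u
    unfolding mid_def ab(3)[OF that, symmetric] by (rule avg2)
  \<comment> \<open>A lower bound, by convexity, for the change of the information number per unit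
    of moved weight; both terms have the same limit.\<close>
  define \<tau> where "\<tau> m' n = (\<Sum>u<l. mid n m u * ln (mid n m u / mid n m' u)) - Id m m' (\<phi> n)" for m' n
  have \<tau>: "\<tau> m' \<longlonglongrightarrow> 0" if m': "m' < M" "m \<noteq> m'" for m'
  proof -
    have "(\<lambda>n. avg 2 (\<lambda>_. 1/2) (pair n) (\<lambda>phi. q k phi u)) \<longlonglongrightarrow> y k u" if "k < M" "u < l" for k u
      unfolding avgq[OF that(1)] by (rule lim_mid[OF that])
    then have "(\<lambda>n. \<Sum>u<l. mid n m u * ln (mid n m u / mid n m' u)) \<longlonglongrightarrow> (\<Sum>u<l. y m u * ln (y m u / y m' u))"
      unfolding avgq[OF m, symmetric] avgq[OF m'(1), symmetric] using m m'
      by (intro Idet_mixture_tendsto mixpair) auto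
    moreover have "(\<lambda>n. Id m m' (\<phi> n)) \<longlonglongrightarrow> (\<Sum>u<l. y m u * ln (y m u / y m' u))"
      by (rule Idet_tendsto[OF m m' D(1)]) (use lim\<phi> m m' in auto)
    ultimately have "\<tau> m' \<longlonglongrightarrow> (\<Sum>u<l. y m u * ln (y m u / y m' u)) - (\<Sum>u<l. y m u * ln (y m u / y m' u))"
      unfolding \<tau>_def by (rule tendsto_diff)
    then show ?thesis by simp
  qed
  have \<tau>_le: "\<tau> m' n \<le> (Id m m' (\<alpha> n) + Id m m' (\<beta> n)) / 2 - Id m m' (\<phi> n)" if m': "m' < M" for m' n
  proof -
    have "(\<Sum>u<l. mid n m u * ln (mid n m u / mid n m' u)) \<le> avg 2 (\<lambda>_. 1/2) (pair n) (Id m m')"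
      unfolding avgq[OF m, symmetric] avgq[OF m', symmetric] by (rule Idet_mixture_ge[OF m m' mixpair])
    also have "\<dots> = (Id m m' (\<alpha> n) + Id m m' (\<beta> n)) / 2" by (rule avg2)
    finally show ?thesis unfolding \<tau>_def by linarith
  qed
  \<comment> \<open>Equal to half of \<open>q m (\<beta> n) u0 - q m (\<alpha> n) u0\<close>, and
    asymptotically equal to \<open>b n\<close>.\<close>
  define X where "X n = b n + (q m (\<psi> n) u0 - q m (\<phi> n) u0) / 2" for n
  define \<kappa> where "\<kappa> n = (\<Sum>u<l. (mid n m u)\<^sup>2) - sqn m (\<phi> n)" for n
  have \<kappa>: "\<kappa> \<longlonglongrightarrow> 0"
  proof -
    have "\<kappa> \<longlonglongrightarrow> (\<Sum>u<l. (y m u)\<^sup>2) - (\<Sum>u<l. (y m u)\<^sup>2)"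
      unfolding \<kappa>_def using lim_mid[OF m] lim\<phi>[OF m] by (intro tendsto_intros) auto
    then show ?thesis by simp
  qed
  \<comment> \<open>The parallelogram identity makes the strict convexity quantitative: splitting
    gains the squared half-difference.\<close>
  have half: "((a + a') / 2)\<^sup>2 + ((a - a') / 2)\<^sup>2 = (a\<^sup>2 + a'\<^sup>2) / 2" for a a' :: real
    by (simp add: power2_eq_square field_simps)
  have sq_ge: "\<kappa> n + (X n)\<^sup>2 \<le> (sqn m (\<alpha> n) + sqn m (\<beta> n)) / 2 - sqn m (\<phi> n)" for n
  proof -
    have "(X n)\<^sup>2 = ((q m (\<alpha> n) u0 - q m (\<beta> n) u0) / 2)\<^sup>2"
    proof -
      have "X n = - ((q m (\<alpha> n) u0 - q m (\<beta> n) u0) / 2)" using ab(4)[of n] by (simp add: X_def field_simps)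
      then show ?thesis by (simp only: power2_minus)
    qed
    also have "\<dots> \<le> (\<Sum>u<l. ((q m (\<alpha> n) u - q m (\<beta> n) u) / 2)\<^sup>2)"
      using u0 by (intro member_le_sum[of u0]) auto
    finally have "(\<Sum>u<l. (mid n m u)\<^sup>2) + (X n)\<^sup>2
       \<le> (\<Sum>u<l. (mid n m u)\<^sup>2 + ((q m (\<alpha> n) u - q m (\<beta> n) u) / 2)\<^sup>2)"
      by (simp add: sum.distrib)
    also have "\<dots> = (\<Sum>u<l. ((q m (\<alpha> n) u)\<^sup>2 + (q m (\<beta> n) u)\<^sup>2) / 2)"
    proof (intro sum.cong refl)
      fix u
      have "mid n m u = (q m (\<alpha> n) u + q m (\<beta> n) u) / 2" using ab(3)[OF m] by (simp add: mid_def)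
      then show "(mid n m u)\<^sup>2 + ((q m (\<alpha> n) u - q m (\<beta> n) u) / 2)\<^sup>2 = ((q m (\<alpha> n) u)\<^sup>2 + (q m (\<beta> n) u)\<^sup>2) / 2"
        by (simp only: half)
    qed
    also have "\<dots> = (sqn m (\<alpha> n) + sqn m (\<beta> n)) / 2" by (simp add: sum.distrib flip: sum_divide_distrib)
    finally show ?thesis by (simp add: \<kappa>_def)
  qed
  have \<delta>r: "(\<lambda>n. \<delta> (r n)) \<longlonglongrightarrow> 0" by (rule filterlim_compose[OF \<delta> rt(1)])
  have "(\<lambda>n. c n * (X n)\<^sup>2) \<longlonglongrightarrow> 0"
  proof (rule order_tendstoI)
    fix e :: real assume "e < 0"
    then show "\<forall>\<^sub>F n in sequentially. e < c n * (X n)\<^sup>2"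
      using c01 by (intro always_eventually allI) (meson less_le_trans mult_nonneg_nonneg zero_le_power2)
  next
    fix e :: real assume e: "0 < e"
    \<comment> \<open>Half of \<open>d\<close> covers the defect \<delta>, half the change \<tau>. A
      quarter of \<open>e\<close> each covers the slack in \<open>max2\<close>, the defect \<delta>
      and the error \<kappa>, which leaves \<open>c n * (X n)\<^sup>2\<close> at most three quarters
      of \<open>e\<close>.\<close>
    then obtain d where d: "d > 0" "\<And>k X \<Psi>. mixture D k X \<Psi> \<Longrightarrow>
      (\<forall>m'<M. m' \<noteq> m \<longrightarrow> V - d \<le> avg k X \<Psi> (Id m m')) \<Longrightarrow> avg k X \<Psi> (sqn m) \<le> s + e / 4"
      using max2[of "e/4"] by auto
    have "\<forall>\<^sub>F n in sequentially. \<forall>m'\<in>{..<M} - {m}. - (d / 2) < \<tau> m' n"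
      using \<tau> d by (intro eventually_ball_finite ballI order_tendstoD(1)[where y=0]) auto
    moreover have "\<forall>\<^sub>F n in sequentially. \<delta> (r n) < min (d / 2) (e / 4)"
      using d e by (intro order_tendstoD(2)[OF \<delta>r]) auto
    moreover have "\<forall>\<^sub>F n in sequentially. - (e / 4) < \<kappa> n"
      using e by (intro order_tendstoD(1)[OF \<kappa>]) auto
    ultimately show "\<forall>\<^sub>F n in sequentially. c n * (X n)\<^sup>2 < e"
    proof eventually_elim
      case (elim n)
      have "V - d \<le> avg (Suc M) (W' n) (\<Phi>' n) (Id m m')" if m': "m' < M" "m' \<noteq> m" for m'
      proof -
        have "- (d / 2) \<le> c n * - (d / 2)" using c01[of n] d(1) mult_right_mono[of "c n" 1 "d / 2"] by simp
        also have "\<dots> \<le> c n * ((Id m m' (\<alpha> n) + Id m m' (\<beta> n)) / 2 - Id m m' (\<phi> n))"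
        proof (rule mult_left_mono)
          have "- (d / 2) < \<tau> m' n" using elim(1) m' by blast
          then show "- (d / 2) \<le> (Id m m' (\<alpha> n) + Id m m' (\<beta> n)) / 2 - Id m m' (\<phi> n)"
            using \<tau>_le[OF m'(1), of n] by linarith
        qed (rule c01)
        finally show ?thesis unfolding avg'[of n "Id m m'"] using opt[OF m', of "r n"] elim(2) by simp
      qed
      then have "avg (Suc M) (W' n) (\<Phi>' n) (sqn m) \<le> s + e / 4" using d(2)[OF mix'] by blast
      then have "avg M (W (r n)) (\<Phi> (r n)) (sqn m)
          + c n * ((sqn m (\<alpha> n) + sqn m (\<beta> n)) / 2 - sqn m (\<phi> n)) \<le> s + e / 4"
        unfolding avg'[of n "sqn m"] .
      moreover have "c n * (\<kappa> n + (X n)\<^sup>2) \<le> c n * ((sqn m (\<alpha> n) + sqn m (\<beta> n)) / 2 - sqn m (\<phi> n))"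
        by (intro mult_left_mono sq_ge c01)
      moreover have "- (e / 4) \<le> c n * \<kappa> n"
      proof -
        have "- (e / 4) \<le> c n * - (e / 4)" using c01[of n] e mult_right_mono[of "c n" 1 "e / 4"] by simp
        also have "\<dots> \<le> c n * \<kappa> n" using elim(3) c01 by (intro mult_left_mono) auto
        finally show ?thesis .
      qed
      moreover have "c n * (\<kappa> n + (X n)\<^sup>2) = c n * \<kappa> n + c n * (X n)\<^sup>2" by (rule distrib_left)
      moreover have "\<delta> (r n) < e / 4" using elim(2) by simp
      ultimately show ?case using opt2[of "r n"] e by linarith
    qed
  qed
  \<comment> \<open>The positive limit weight \<open>w\<close> is used here: the factor
    \<open>c n\<close> can be divided out.\<close>
  from tendsto_divide[OF this c] have "(\<lambda>n. c n * (X n)\<^sup>2 / c n) \<longlonglongrightarrow> 0" using w by simp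
  moreover have "\<forall>\<^sub>F n in sequentially. c n * (X n)\<^sup>2 / c n = (X n)\<^sup>2"
    using order_tendstoD(1)[OF c w] by eventually_elim simp
  ultimately have "(\<lambda>n. (X n)\<^sup>2) \<longlonglongrightarrow> 0" by (rule Lim_transform_eventually)
  then have "X \<longlonglongrightarrow> 0"
    using tendsto_real_sqrt[of "\<lambda>n. (X n)\<^sup>2" 0 sequentially] by (simp add: tendsto_rabs_zero_iff)
  moreover have "(\<lambda>n. (q m (\<psi> n) u0 - q m (\<phi> n) u0) / 2) \<longlonglongrightarrow> (y m u0 - y m u0) / 2"
    by (intro tendsto_intros lim\<phi> lim\<psi> m u0) auto
  ultimately have "(\<lambda>n. X n - (q m (\<psi> n) u0 - q m (\<phi> n) u0) / 2) \<longlonglongrightarrow> 0 - (y m u0 - y m u0) / 2"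
    by (rule tendsto_diff)
  then show ?thesis by (simp add: X_def b_def \<phi>_def \<psi>_def)
qed

text \<open>Along a subsequence all weights and message probabilities converge. Components with
  positive limit weight converge to quantizers by the Cauchy property, and the others contribute
  nothing in the limit.\<close>

lemma maximin_mixture_exists:
  assumes m: "m < M"
  obtains W \<Phi> where "mixture D M W \<Phi>"
    "\<And>m'. m' < M \<Longrightarrow> m' \<noteq> m \<Longrightarrow> Imax mu f M l m \<le> avg M W \<Phi> (Id m m')"
proof -
  let ?V = "Imax mu f M l m"
  obtain W0 \<Phi>0 s where seq: "\<And>n::nat. mixture D M (W0 n) (\<Phi>0 n)"
    "\<And>n m'. m' < M \<Longrightarrow> m' \<noteq> m \<Longrightarrow> ?V - 1 / real (Suc n) \<le> avg M (W0 n) (\<Phi>0 n) (Id m m')"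
    "\<And>n. s - 1 / real (Suc n) \<le> avg M (W0 n) (\<Phi>0 n) (sqn m)"
    "\<And>e. 0 < e \<Longrightarrow> \<exists>d>0. \<forall>k V \<Psi>. mixture D k V \<Psi> \<longrightarrow>
      (\<forall>m'<M. m' \<noteq> m \<longrightarrow> ?V - d \<le> avg k V \<Psi> (Id m m')) \<longrightarrow> avg k V \<Psi> (sqn m) \<le> s + e"
    using lexicographically_maximizing_mixtures[OF m] by blast
  have W01: "0 \<le> W0 n i \<and> W0 n i \<le> 1" if "i < M" for n i
  proof
    show "0 \<le> W0 n i" using seq(1) that by (auto simp: mixture_def)
    have "W0 n i \<le> (\<Sum>j<M. W0 n j)" using seq(1) that by (intro member_le_sum) (auto simp: mixture_def)
    then show "W0 n i \<le> 1" using seq(1) by (simp add: mixture_def)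
  qed
  have "\<bar>W0 n i\<bar> \<le> 1" if "i \<in> {..<M}" for i n using W01[of i n] that by auto
  then obtain \<rho> where \<rho>: "strict_mono (\<rho> :: nat \<Rightarrow> nat)" "\<And>i. i < M \<Longrightarrow> convergent (\<lambda>n. W0 (\<rho> n) i)"
    using common_convergent_subsequence[of "{..<M}" "\<lambda>i n. W0 n i" 1] by auto
  define x where "x = (\<lambda>(i, k, u) n. q k (\<Phi>0 (\<rho> n) i) u)"
  have "\<bar>x a n\<bar> \<le> 1" if "a \<in> {..<M} \<times> {..<M} \<times> {..<l}" for a n
    using that by (auto simp: x_def qpmf_bounds)
  then obtain \<sigma> where \<sigma>: "strict_mono (\<sigma> :: nat \<Rightarrow> nat)"
    "\<And>a. a \<in> {..<M} \<times> {..<M} \<times> {..<l} \<Longrightarrow> convergent (\<lambda>n. x a (\<sigma> n))"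
    using common_convergent_subsequence[of "{..<M} \<times> {..<M} \<times> {..<l}" x 1] by blast
  define \<theta> where "\<theta> n = \<rho> (\<sigma> n)" for n
  have \<theta>: "strict_mono \<theta>" using \<rho>(1) \<sigma>(1) by (auto simp: \<theta>_def strict_mono_def)
  define W where "W n = W0 (\<theta> n)" for n
  define \<Phi> where "\<Phi> n = \<Phi>0 (\<theta> n)" for n
  define w where "w i = lim (\<lambda>n. W n i)" for i
  define y where "y i k u = lim (\<lambda>n. q k (\<Phi> n i) u)" for i k u
  have Wlim: "(\<lambda>n. W n i) \<longlonglongrightarrow> w i" if "i < M" for i
    using convergent_subseq_convergent[OF \<rho>(2)[OF that] \<sigma>(1)]
    by (simp add: w_def W_def \<theta>_def o_def convergent_LIMSEQ_iff)
  have lim: "(\<lambda>n. q k (\<Phi> n i) u) \<longlonglongrightarrow> y i k u" if "i < M" "k < M" "u < l" for i k u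
    using \<sigma>(2)[of "(i, k, u)"] that
    by (simp add: y_def \<Phi>_def \<theta>_def x_def convergent_LIMSEQ_iff)
  have mix: "mixture D M (W n) (\<Phi> n)" for n using seq(1) by (simp add: W_def \<Phi>_def)
  define \<delta> where "\<delta> n = 1 / real (Suc (\<theta> n))" for n
  have \<delta>: "\<delta> \<longlonglongrightarrow> 0"
    using LIMSEQ_subseq_LIMSEQ[OF LIMSEQ_Suc[OF lim_1_over_n] \<theta>] by (simp add: \<delta>_def[abs_def] o_def)
  have opt: "?V - \<delta> n \<le> avg M (W n) (\<Phi> n) (Id m m')" if "m' < M" "m' \<noteq> m" for n m'
    unfolding W_def \<Phi>_def \<delta>_def by (rule seq(2)[OF that])
  have opt2: "s - \<delta> n \<le> avg M (W n) (\<Phi> n) (sqn m)" for n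
    unfolding W_def \<Phi>_def \<delta>_def by (rule seq(3))
  have w0: "0 \<le> w i" if "i < M" for i
    using LIMSEQ_le_const[OF Wlim[OF that], of 0] W01[OF that] by (auto simp: W_def)
  \<comment> \<open>A component of limit weight 0 need not have a limit; the constant quantizer
    fills its slot.\<close>
  have "\<exists>phi. phi \<in> D \<and> (0 < w i \<longrightarrow> (\<forall>k<M. \<forall>u<l. q k phi u = y i k u))" if i: "i < M" for i
  proof (cases "0 < w i")
    case True
    have Di: "\<Phi> n i \<in> D" for n using mix i by (auto simp: mixture_def)
    show ?thesis
    proof (rule Cauchy_limit_quantizer[OF m Di])
      show "(\<lambda>n. measure (P m) {x\<in>space mu. \<Phi> (r n) i x = u \<and> \<Phi> (t n) i x \<noteq> u}) \<longlonglongrightarrow> 0"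
        if "\<And>n. n \<le> r n" "\<And>n. n \<le> t n" "u < l" for r t u
        by (rule maximizing_components_Cauchy[OF m i True mix opt opt2 \<delta> seq(4) Wlim[OF i] lim[OF i] that])
      show "(\<lambda>n. q k (\<Phi> n i) u) \<longlonglongrightarrow> y i k u" if "k < M" "u < l" for k u by (rule lim[OF i that])
    qed blast
  qed (use det_quantizer_const in blast)
  then obtain \<phi> where \<phi>: "\<And>i. i < M \<Longrightarrow> \<phi> i \<in> D"
    "\<And>i k u. i < M \<Longrightarrow> 0 < w i \<Longrightarrow> k < M \<Longrightarrow> u < l \<Longrightarrow> q k (\<phi> i) u = y i k u" by metis
  have "(\<lambda>n. \<Sum>i<M. W n i) \<longlonglongrightarrow> (\<Sum>i<M. w i)" by (intro tendsto_sum Wlim) auto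
  moreover have "(\<lambda>n. \<Sum>i<M. W n i) = (\<lambda>_. 1)" using mix by (auto simp: mixture_def)
  ultimately have "(\<Sum>i<M. w i) = 1" using LIMSEQ_unique[OF _ tendsto_const] by metis
  then have "mixture D M w \<phi>" using w0 \<phi>(1) by (simp add: mixture_def)
  moreover have "?V \<le> avg M w \<phi> (Id m m')" if m': "m' < M" "m' \<noteq> m" for m'
  proof -
    obtain C where C: "\<And>m' phi. m' < M \<Longrightarrow> m' \<noteq> m \<Longrightarrow> phi \<in> D \<Longrightarrow> Id m m' phi \<le> C"
      using Idet_bounded[OF m] by blast
    have "(\<lambda>n. avg M (W n) (\<Phi> n) (Id m m')) \<longlonglongrightarrow> avg M w \<phi> (Id m m')"
    proof (rule tendsto_sum)
      fix i assume "i \<in> {..<M}"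
      then have i: "i < M" by simp
      have Di: "\<Phi> n i \<in> D" for n using mix i by (auto simp: mixture_def)
      show "(\<lambda>n. W n i * Id m m' (\<Phi> n i)) \<longlonglongrightarrow> w i * Id m m' (\<phi> i)"
      proof (cases "0 < w i")
        case True
        have "Id m m' (\<phi> i) = (\<Sum>u<l. y i m u * ln (y i m u / y i m' u))"
          unfolding Idet_def using \<phi>(2)[OF i True] m m' by (intro sum.cong) auto
        moreover have "(\<lambda>n. Id m m' (\<Phi> n i)) \<longlonglongrightarrow> (\<Sum>u<l. y i m u * ln (y i m u / y i m' u))"
          by (rule Idet_tendsto[OF m m'(1) m'(2)[symmetric] Di]) (use lim i m m' in auto)
        ultimately show ?thesis by (intro tendsto_mult Wlim i) simp
      next
        case False
        then have wi: "w i = 0" using w0[OF i] by simp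
        \<comment> \<open>Vanishing weight times a bounded nonnegative information number.\<close>
        have "(\<lambda>n. W n i * Id m m' (\<Phi> n i)) \<longlonglongrightarrow> 0"
        proof (rule tendsto_sandwich[where f = "\<lambda>_. 0" and h = "\<lambda>n. W n i * C"])
          show "(\<lambda>n. W n i * C) \<longlonglongrightarrow> 0" using tendsto_mult_right[OF Wlim[OF i], of C] wi by simp
          show "\<forall>\<^sub>F n in sequentially. 0 \<le> W n i * Id m m' (\<Phi> n i)"
            using W01[OF i] Idet_nonneg[OF m m'(1) Di] by (auto simp: W_def)
          show "\<forall>\<^sub>F n in sequentially. W n i * Id m m' (\<Phi> n i) \<le> W n i * C"
            by (intro always_eventually allI mult_left_mono C[OF m' Di]) (simp add: W_def W01[OF i])
        qed simp
        then show ?thesis by (simp add: wi)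
      qed
    qed
    then have "?V - 0 \<le> avg M w \<phi> (Id m m')"
      by (rule LIMSEQ_le[OF tendsto_diff[OF tendsto_const \<delta>]]) (use opt[OF m'] in blast)
    then show ?thesis by simp
  qed
  ultimately show ?thesis using that by blast
qed

section \<open>Conclusion: maximin quantizers with M - 1 components and ULQ sequences\<close>

lemma reduced_maximin_quantizer:
  assumes m: "m < M"
  shows "\<exists>p. maximin mu f M l m p \<and> finite (set_pmf p) \<and> card (set_pmf p) \<le> M - 1"
proof -
  obtain W \<Phi> where W: "mixture D M W \<Phi>"
    "\<And>m'. m' < M \<Longrightarrow> m' \<noteq> m \<Longrightarrow> Imax mu f M l m \<le> avg M W \<Phi> (Id m m')"
    using maximin_mixture_exists[OF m] by blast
  obtain W' \<Phi>' where W': "mixture D (M - 1) W' \<Phi>'"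
    "\<And>m'. m' < M \<Longrightarrow> m' \<noteq> m \<Longrightarrow> avg M W \<Phi> (Id m m') \<le> avg (M - 1) W' \<Phi>' (Id m m')"
    using mixture_reduce[OF m W(1)] by blast
  obtain p where p: "set_pmf p \<subseteq> D" "finite (set_pmf p)" "card (set_pmf p) \<le> M - 1"
    "\<And>g. measure_pmf.expectation p g = avg (M - 1) W' \<Phi>' g"
    using mixture_pmf[OF W'(1)] by blast
  have "Imax mu f M l m \<le> Imin mu f M l m p"
    using le_Imin_iff[OF m] order_trans[OF W(2) W'(2)] by (auto simp: Irand_def p(4))
  moreover have "quantizer mu l p" using p by (simp add: quantizer_def)
  ultimately have "maximin mu f M l m p" using Imin_le_Imax[OF m] by (auto simp: maximin_def intro: antisym)
  with p show ?thesis by blast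
qed

lemma ULQ_maximizing_sequence:
  assumes m: "m < M"
  shows "\<exists>p :: nat \<Rightarrow> ('a \<Rightarrow> nat) pmf.
      (\<forall>i. quantizer mu l (p i) \<and> set_pmf (p i) \<subseteq> U \<and> finite (set_pmf (p i)) \<and> card (set_pmf (p i)) \<le> M - 1)
      \<and> (\<lambda>i. Imin mu f M l m (p i)) \<longlonglongrightarrow> Imax mu f M l m"
proof -
  let ?V = "Imax mu f M l m"
  obtain W \<Phi> where W: "mixture D M W \<Phi>"
    "\<And>m'. m' < M \<Longrightarrow> m' \<noteq> m \<Longrightarrow> ?V \<le> avg M W \<Phi> (Id m m')"
    using maximin_mixture_exists[OF m] by blast
  have "\<exists>p. quantizer mu l p \<and> set_pmf p \<subseteq> U \<and> finite (set_pmf p) \<and> card (set_pmf p) \<le> M - 1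
      \<and> ?V - 1 / real (Suc i) \<le> Imin mu f M l m p" for i
  proof -
    obtain W' \<Phi>' where W': "mixture U (M - 1) W' \<Phi>'"
      "\<And>m'. m' < M \<Longrightarrow> m' \<noteq> m \<Longrightarrow> avg M W \<Phi> (Id m m') - 1 / real (Suc i) \<le> avg (M - 1) W' \<Phi>' (Id m m')"
      using mixture_approximated_by_ULQ_mixture[OF m W(1), of "1 / real (Suc i)"] by auto
    obtain p where p: "set_pmf p \<subseteq> U" "finite (set_pmf p)" "card (set_pmf p) \<le> M - 1"
      "\<And>g. measure_pmf.expectation p g = avg (M - 1) W' \<Phi>' g"
      using mixture_pmf[OF W'(1)] by blast
    have "?V - 1 / real (Suc i) \<le> avg (M - 1) W' \<Phi>' (Id m m')" if "m' < M" "m' \<noteq> m" for m'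
      using W(2)[OF that] W'(2)[OF that] by linarith
    then have "?V - 1 / real (Suc i) \<le> Imin mu f M l m p"
      using le_Imin_iff[OF m] by (auto simp: Irand_def p(4))
    with p U_subset_D show ?thesis by (auto simp: quantizer_def)
  qed
  then obtain p where p: "\<And>i. quantizer mu l (p i) \<and> set_pmf (p i) \<subseteq> U \<and> finite (set_pmf (p i)) \<and>
      card (set_pmf (p i)) \<le> M - 1 \<and> ?V - 1 / real (Suc i) \<le> Imin mu f M l m (p i)" by metis
  have "(\<lambda>i. Imin mu f M l m (p i)) \<longlonglongrightarrow> ?V"
  proof (rule tendsto_sandwich)
    show "(\<lambda>i. ?V - 1 / real (Suc i)) \<longlonglongrightarrow> ?V"
      using tendsto_diff[OF tendsto_const LIMSEQ_Suc[OF lim_1_over_n]] by fastforce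
    show "\<forall>\<^sub>F i in sequentially. Imin mu f M l m (p i) \<le> ?V"
      using p Imin_le_Imax[OF m] by (intro always_eventually) blast
  qed (use p in auto)
  with p show ?thesis by blast
qed

end

theorem theorem5p1:
  fixes mu :: "'a measure" and f :: "nat \<Rightarrow> 'a \<Rightarrow> real" and M l :: nat
  assumes "sigma_finite_measure mu"
    and "M \<ge> 2" and "l \<ge> 2"
    and dens: "\<And>m. m < M \<Longrightarrow> f m \<in> borel_measurable mu \<and> (\<forall>x\<in>space mu. 0 \<le> f m x)
                 \<and> (\<integral>\<^sup>+ x. ennreal (f m x) \<partial>mu) = 1"
    and KL: "\<And>m m'. m < M \<Longrightarrow> m' < M \<Longrightarrow> m \<noteq> m' \<Longrightarrow>
               (AE x in Pm mu f m. 0 < f m' x)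
             \<and> integrable (Pm mu f m) (\<lambda>x. ln (f m x / f m' x))
             \<and> 0 < (\<integral>x. ln (f m x / f m' x) \<partial>Pm mu f m)"
  shows "\<forall>m<M.
           (\<exists>p. maximin mu f M l m p \<and> finite (set_pmf p) \<and> card (set_pmf p) \<le> M - 1)
         \<and> (\<exists>q :: nat \<Rightarrow> ('a \<Rightarrow> nat) pmf.
              (\<forall>i. quantizer mu l (q i) \<and> set_pmf (q i) \<subseteq> {phi. ULQ mu f M l phi}
                   \<and> finite (set_pmf (q i)) \<and> card (set_pmf (q i)) \<le> M - 1)
            \<and> (\<lambda>i. Imin mu f M l m (q i)) \<longlonglongrightarrow> Imax mu f M l m)"
proof -
  interpret hypotheses mu f M l
    using assms by unfold_locales
  show ?thesis
    using reduced_maximin_quantizer ULQ_maximizing_sequence by blast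
qed

end
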